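(* Let $m\ge 5$, $n\ge 3$, $n\ne 4$ be integers. Let $w\ge 0$ be an integer such that $m-nw$ is even, and set $r=(m-nw)/2$. Let $X_w$ be the subcomplex of $\mathrm{Hom}(C_m,C_n)$ induced by the vertices with winding number $w$. If $r>0$, then the cubical complex $X_w$ collapses to a subcomplex consisting of $mn/\gcd(m,r)$ cubes (together with their faces), each of dimension $\gcd(m,r)$. These cubes are linked by their diagonally opposite vertices to form $2$ circles if both $m$ and $n$ are even, and one circle otherwise.
   Context: $C_m$ is the cycle with vertex set $\mathbb Z/m$ and edges between $i$ and $i+1$. For graphs $T$ and $G$, $\mathrm{Hom}(T,G)$ is the polyhedral complex whose cells are the products $\sigma=\prod_{x\in V(T)}\sigma_x$ of simplices, with each $\sigma_x$ a nonempty subset of $V(G)$, such that whenever $(x,y)\in E(T)$ one has $\sigma_x\times\sigma_y\subseteq E(G)$. Its vertices are the graph homomorphisms $T\to G$. For the $m,n$ considered, $\mathrm{Hom}(C_m,C_n)$ is a cubical complex. The winding number of a graph homomorphism $\varphi:C_m\to C_n$ is the degree of the induced map of circles: $\bigl(\#\{i:\varphi(i+1)-\varphi(i)=1\}-\#\{i:\varphi(i+1)-\varphi(i)=-1\}\bigr)/n$, with differences taken in $\mathbb Z/n$. $X_w$ consists of all cells of $\mathrm{Hom}(C_m,C_n)$ all of whose vertices have winding number $w$. A family of cubes is "linked by opposite vertices to form one circle" if the cubes can be numbered $Q_i$, $i\in\mathbb Z/N$, so that there are distinct vertices $v_i$, $i\in\mathbb Z/N$, with $v_i,v_{i+1}$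 diagonally opposite vertices of $Q_i$ and $Q_i\cap Q_j=\{v_i,v_{i+1}\}\cap\{v_j,v_{j+1}\}$ for $i\ne j$. It forms two circles if it is the union of two such families that are disjoint from each other. "Collapses" means that there is a sequence of (elementary) collapses of cells. *)

theory Defs
  imports "Graph_Theory.Pair_Digraph" "HOL-Number_Theory.Cong" "HOL-Library.FuncSet"
begin

text \<open>
  Undirected graphs are symmetric digraphs without parallel arcs. The elements of
  \<open>\<int>/m\<close> are represented by \<open>0, \<dots>, m - 1\<close>.
\<close>

definition cycle_graph :: "int \<Rightarrow> int pair_pre_digraph" where
  "cycle_graph m = \<lparr> pverts = {0..<m},
     parcs = {(i, j). i \<in> {0..<m} \<and> j \<in> {0..<m} \<and> ([j = i + 1] (mod m) \<or> [i = j + 1] (mod m))} \<rparr>"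

lemma pair_graph_cycle_graph:
  assumes "m \<ge> 2"
  shows "pair_graph (cycle_graph m)"
proof
  show "finite (parcs (cycle_graph m))"
    by (rule finite_subset[of _ "{0..<m} \<times> {0..<m}"]) (auto simp: cycle_graph_def)
  show "symmetric (with_proj (cycle_graph m))"
    by (auto simp: symmetric_def sym_def cycle_graph_def)
  show "fst e \<noteq> snd e" if "e \<in> parcs (cycle_graph m)" for e
    using that assms by (auto simp: cycle_graph_def cong_iff_dvd_diff zdvd_not_zless)
qed (auto simp: cycle_graph_def)

definition graph_homs :: "'a pair_pre_digraph \<Rightarrow> 'b pair_pre_digraph \<Rightarrow> ('a \<Rightarrow> 'b) set" where
  "graph_homs T G =
     {\<phi> \<in> pverts T \<rightarrow>\<^sub>E pverts G. \<forall>(x, y) \<in> parcs T. (\<phi> x, \<phi> y) \<in> parcs G}"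

text \<open>
  A cell \<open>\<Prod>x\<in>V(T). \<sigma>\<^sub>x\<close> of the polyhedral complex \<open>Hom(T, G)\<close> is represented by the family
  \<open>\<sigma>\<close>, where \<open>\<sigma>\<^sub>x\<close> is the vertex set of a simplex. Families are extensional (\<^const>\<open>undefined\<close>
  outside \<open>V(T)\<close>), so that equality of families is equality of cells.
\<close>

definition hom_complex :: "'a pair_pre_digraph \<Rightarrow> 'b pair_pre_digraph \<Rightarrow> ('a \<Rightarrow> 'b set) set" where
  "hom_complex T G =
     {\<sigma> \<in> (\<Pi>\<^sub>E x\<in>pverts T. Pow (pverts G) - {{}}). \<forall>(x, y) \<in> parcs T. \<sigma> x \<times> \<sigma> y \<subseteq> parcs G}"

text \<open>All nonempty faces, including the cell itself.\<close>

definition faces :: "'a pair_pre_digraph \<Rightarrow> ('a \<Rightarrow> 'b set) \<Rightarrow> ('a \<Rightarrow> 'b set) set" where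
  "faces T \<sigma> = (\<Pi>\<^sub>E x\<in>pverts T. Pow (\<sigma> x) - {{}})"

definition cell_dim :: "'a pair_pre_digraph \<Rightarrow> ('a \<Rightarrow> 'b set) \<Rightarrow> nat" where
  "cell_dim T \<sigma> = (\<Sum>x\<in>pverts T. card (\<sigma> x) - 1)"

text \<open>
  Vertices of a cell are given as maps \<open>V(T) \<rightarrow> V(G)\<close>; \<open>vertex_cell\<close> turns such a map into the
  corresponding cell of dimension \<open>0\<close>.
\<close>

definition cell_vertices :: "'a pair_pre_digraph \<Rightarrow> ('a \<Rightarrow> 'b set) \<Rightarrow> ('a \<Rightarrow> 'b) set" where
  "cell_vertices T \<sigma> = (\<Pi>\<^sub>E x\<in>pverts T. \<sigma> x)"

definition vertex_cell :: "'a pair_pre_digraph \<Rightarrow> ('a \<Rightarrow> 'b) \<Rightarrow> ('a \<Rightarrow> 'b set)" where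
  "vertex_cell T \<phi> = (\<lambda>x\<in>pverts T. {\<phi> x})"

text \<open>The vertices of \<open>Hom(T, G)\<close> are the graph homomorphisms.\<close>

lemma vertex_cell_in_hom_complex_iff:
  assumes "pair_wf_digraph T" and "\<phi> \<in> extensional (pverts T)"
  shows "vertex_cell T \<phi> \<in> hom_complex T G \<longleftrightarrow> \<phi> \<in> graph_homs T G"
  using assms pair_wf_digraph.wellformed'[OF assms(1)]
  by (fastforce simp: vertex_cell_def hom_complex_def graph_homs_def PiE_iff)

text \<open>A product of simplices is a cube iff each factor is a point or an edge.\<close>

definition is_cube :: "'a pair_pre_digraph \<Rightarrow> ('a \<Rightarrow> 'b set) \<Rightarrow> bool" where
  "is_cube T \<sigma> \<longleftrightarrow> (\<forall>x\<in>pverts T. card (\<sigma> x) = 1 \<or> card (\<sigma> x) = 2)"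

lemma is_cube_hom_complex_cycle:
  assumes "m \<ge> 2" and "n \<ge> 3" and "\<sigma> \<in> hom_complex (cycle_graph m) (cycle_graph n)"
  shows "is_cube (cycle_graph m) \<sigma>"
  unfolding is_cube_def
proof
  fix x assume x: "x \<in> pverts (cycle_graph m)"
  define y where "y = (x + 1) mod m"
  have y: "y \<in> {0..<m}" and e: "(x, y) \<in> parcs (cycle_graph m)"
    using x assms(1) by (auto simp: cycle_graph_def y_def cong_def)
  have ne: "\<sigma> z \<noteq> {}" "\<sigma> z \<subseteq> {0..<n}" if "z \<in> {0..<m}" for z
    using assms(3) that by (auto simp: hom_complex_def cycle_graph_def PiE_iff)
  obtain b where b: "b \<in> \<sigma> y" using ne(1)[OF y] by auto
  have sub: "\<sigma> x \<subseteq> {(b + 1) mod n, (b - 1) mod n}"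
  proof
    fix a assume a: "a \<in> \<sigma> x"
    hence "(a, b) \<in> parcs (cycle_graph n)"
      using assms(3) e b by (auto simp: hom_complex_def)
    hence "0 \<le> a" "a < n" "[b = a + 1] (mod n) \<or> [a = b + 1] (mod n)"
      by (auto simp: cycle_graph_def)
    moreover have "[a = b - 1] (mod n)" if "[b = a + 1] (mod n)"
      using cong_diff[OF that cong_refl[of 1]] by (simp add: cong_sym)
    ultimately show "a \<in> {(b + 1) mod n, (b - 1) mod n}"
      by (auto simp: cong_def)
  qed
  have "card (\<sigma> x) \<le> card {(b + 1) mod n, (b - 1) mod n}"
    by (rule card_mono[OF _ sub]) simp
  also have "\<dots> \<le> 2" by (simp add: card_insert_if)
  finally have "card (\<sigma> x) \<le> 2" .
  moreover have "card (\<sigma> x) > 0"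
    using ne(1)[of x] x finite_subset[OF sub] by (auto simp: cycle_graph_def card_gt_0_iff)
  ultimately show "card (\<sigma> x) = 1 \<or> card (\<sigma> x) = 2" by linarith
qed

text \<open>Opposite vertices of a cube differ in each of its edge factors.\<close>

definition diagonally_opposite ::
    "'a pair_pre_digraph \<Rightarrow> ('a \<Rightarrow> 'b set) \<Rightarrow> ('a \<Rightarrow> 'b) \<Rightarrow> ('a \<Rightarrow> 'b) \<Rightarrow> bool" where
  "diagonally_opposite T \<sigma> u v \<longleftrightarrow> u \<in> cell_vertices T \<sigma> \<and> v \<in> cell_vertices T \<sigma> \<and>
     (\<forall>x\<in>pverts T. card (\<sigma> x) = 2 \<longrightarrow> u x \<noteq> v x)"

text \<open>
  Removal of a maximal cell \<open>\<sigma>\<close> together with a free face \<open>\<tau>\<close> of codimension one, i.e. a face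
  properly contained in no cell but \<open>\<sigma>\<close>.
\<close>

definition elementary_collapse ::
    "'a pair_pre_digraph \<Rightarrow> ('a \<Rightarrow> 'b set) set \<Rightarrow> ('a \<Rightarrow> 'b set) set \<Rightarrow> bool" where
  "elementary_collapse T K L \<longleftrightarrow> (\<exists>\<sigma>\<in>K. \<exists>\<tau>\<in>K. \<tau> \<in> faces T \<sigma> \<and> cell_dim T \<sigma> = cell_dim T \<tau> + 1 \<and>
     (\<forall>\<rho>\<in>K. \<tau> \<in> faces T \<rho> \<longrightarrow> \<rho> = \<tau> \<or> \<rho> = \<sigma>) \<and> L = K - {\<sigma>, \<tau>})"

abbreviation collapses ::
    "'a pair_pre_digraph \<Rightarrow> ('a \<Rightarrow> 'b set) set \<Rightarrow> ('a \<Rightarrow> 'b set) set \<Rightarrow> bool" where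
  "collapses T \<equiv> (elementary_collapse T)\<^sup>*\<^sup>*"

text \<open>
  In a polyhedral complex two closed cells intersect in the union of their common faces, so
  intersections of closed cells are expressed by their sets of common faces.
\<close>

definition linked_to_circle :: "'a pair_pre_digraph \<Rightarrow> ('a \<Rightarrow> 'b set) set \<Rightarrow> bool" where
  "linked_to_circle T \<Q> \<longleftrightarrow> (\<exists>N>0. \<exists>Q :: nat \<Rightarrow> 'a \<Rightarrow> 'b set. \<exists>v :: nat \<Rightarrow> 'a \<Rightarrow> 'b.
     bij_betw Q {..<N} \<Q> \<and> inj_on v {..<N} \<and>
     (\<forall>i<N. diagonally_opposite T (Q i) (v i) (v (Suc i mod N))) \<and>
     (\<forall>i<N. \<forall>j<N. i \<noteq> j \<longrightarrow> faces T (Q i) \<inter> faces T (Q j) =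
        vertex_cell T ` ({v i, v (Suc i mod N)} \<inter> {v j, v (Suc j mod N)})))"

definition linked_to_two_circles :: "'a pair_pre_digraph \<Rightarrow> ('a \<Rightarrow> 'b set) set \<Rightarrow> bool" where
  "linked_to_two_circles T \<Q> \<longleftrightarrow> (\<exists>\<A> \<B>. \<Q> = \<A> \<union> \<B> \<and>
     linked_to_circle T \<A> \<and> linked_to_circle T \<B> \<and>
     (\<Union>A\<in>\<A>. faces T A) \<inter> (\<Union>B\<in>\<B>. faces T B) = {})"

definition hom_winding_number :: "int \<Rightarrow> int \<Rightarrow> (int \<Rightarrow> int) \<Rightarrow> rat" where
  "hom_winding_number m n \<phi> =
     (of_nat (card {i \<in> {0..<m}. [\<phi> ((i + 1) mod m) - \<phi> i = 1] (mod n)}) -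
      of_nat (card {i \<in> {0..<m}. [\<phi> ((i + 1) mod m) - \<phi> i = -1] (mod n)})) / of_int n"

definition winding_subcomplex :: "int \<Rightarrow> int \<Rightarrow> int \<Rightarrow> (int \<Rightarrow> int set) set" where
  "winding_subcomplex m n w =
     {\<sigma> \<in> hom_complex (cycle_graph m) (cycle_graph n).
        \<forall>\<phi>\<in>cell_vertices (cycle_graph m) \<sigma>. hom_winding_number m n \<phi> = of_int w}"

end

theory Submission
  imports Defs "HOL-Library.Product_Lexorder"
begin

text \<open>
  Put \<open>s = m - r\<close>. A homomorphism \<open>\<phi> : C\<^sub>m \<rightarrow> C\<^sub>n\<close> of winding number \<open>w\<close> lifts to
  \<open>f(x) = c - x + 2 k(x)\<close> on the integers, where \<open>k\<close> increases by \<open>0\<close> or \<open>1\<close> in each step and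
  \<open>k(x + m) = k(x) + s\<close>. A cell of \<open>X\<^sub>w\<close> thus becomes an interval \<open>[lo, hi]\<close> of such functions,
  unique up to translation by the multiples of a constant \<open>p\<close>.

  At a point \<open>a\<close> where \<open>m lo(x) - s x\<close> is minimal, \<open>lo\<close> has a corner, so \<open>hi(a)\<close> may be switched
  between \<open>lo(a)\<close> and \<open>lo(a) + 1\<close>. Switching at the first such \<open>a\<close> in \<open>{0..<m}\<close> is a matching of the
  cells for which \<open>max (m hi(x) - s x) - min (m lo(x) - s x) > m\<close>, and these collapse in the order of
  decreasing width. The remaining cells are those in the intervals between consecutive functions
  \<open>K\<^sub>t(x) = \<lfloor>(g t + s x) / m\<rfloor>\<close>, \<open>g = gcd(m, s)\<close>. Since \<open>K\<^sub>t\<close> is strictly monotone in \<open>t\<close> and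
  \<open>K\<^sub>t\<^sub>+\<^sub>m\<^sub>/\<^sub>g = K\<^sub>t + 1\<close>, the intervals form a circle of \<open>p m / g\<close> cubes. If \<open>n\<close> is even, then
  \<open>p = n / 2\<close> and there is one circle for each parity of \<open>c\<close>; if \<open>n\<close> is odd, then \<open>p = n\<close>.
\<close>

section \<open>Collapsing a complex along a matching of its cells\<close>

text \<open>The cells are removed in the order of increasing keys.\<close>

lemma collapses_matching:
  fixes key :: "('a \<Rightarrow> 'b set) \<Rightarrow> 'k::linorder"
  assumes "finite K" and "L \<subseteq> K"
    and match: "\<And>\<tau>. \<tau> \<in> K - L \<Longrightarrow>
      match \<tau> \<in> K - L \<and> match (match \<tau>) = \<tau> \<and> key (match \<tau>) = key \<tau>"
    and face: "\<And>\<tau>. \<tau> \<in> K - L \<Longrightarrow>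
      \<tau> \<in> faces T (match \<tau>) \<and> cell_dim T (match \<tau>) = cell_dim T \<tau> + 1 \<or>
      match \<tau> \<in> faces T \<tau> \<and> cell_dim T \<tau> = cell_dim T (match \<tau>) + 1"
    and decreasing: "\<And>\<tau> \<rho>. \<tau> \<in> K - L \<Longrightarrow> \<tau> \<in> faces T (match \<tau>) \<Longrightarrow>
      cell_dim T (match \<tau>) = cell_dim T \<tau> + 1 \<Longrightarrow> \<rho> \<in> K \<Longrightarrow> \<tau> \<in> faces T \<rho> \<Longrightarrow>
      \<rho> = \<tau> \<or> \<rho> = match \<tau> \<or> \<rho> \<in> K - L \<and> key \<rho> < key \<tau>"
  shows "collapses T K L"
  using assms
proof (induction "card (K - L)" arbitrary: K rule: less_induct)
  case less
  note match = less.prems(3) and face = less.prems(4) and decreasing = less.prems(5)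
  show ?case
  proof (cases "K - L = {}")
    case True
    with less.prems(2) have "K = L" by auto
    then show ?thesis by simp
  next
    case False
    have fin: "finite (K - L)" using less.prems(1) by simp
    obtain \<tau>0 where \<tau>0: "\<tau>0 \<in> K - L" "key \<tau>0 = Min (key ` (K - L))"
      using Min_in[of "key ` (K - L)"] fin False
      by (metis (no_types, lifting) finite_imageI image_iff image_is_empty)
    \<comment> \<open>A cell of minimal key and its partner have the same key; the lower one of the
      two is taken.\<close>
    have "\<exists>\<tau>\<in>K - L. key \<tau> = Min (key ` (K - L)) \<and> \<tau> \<in> faces T (match \<tau>) \<and>
        cell_dim T (match \<tau>) = cell_dim T \<tau> + 1"
      using face[OF \<tau>0(1)] match[OF \<tau>0(1)] \<tau>0 by metis
    then obtain \<tau> where \<tau>: "\<tau> \<in> K - L" "key \<tau> = Min (key ` (K - L))"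
      "\<tau> \<in> faces T (match \<tau>)" "cell_dim T (match \<tau>) = cell_dim T \<tau> + 1"
      by auto
    have min: "key \<tau> \<le> key \<rho>" if "\<rho> \<in> K - L" for \<rho>
      unfolding \<tau>(2) using fin that by simp
    define K' where "K' = K - {match \<tau>, \<tau>}"
    have "elementary_collapse T K K'"
      unfolding elementary_collapse_def
    proof (intro bexI conjI ballI impI)
      \<comment> \<open>Any other coface would be a cell of \<open>K - L\<close> with a smaller key,
        against minimality; so \<tau> is a free face.\<close>
      fix \<rho> assume "\<rho> \<in> K" "\<tau> \<in> faces T \<rho>"
      with decreasing[OF \<tau>(1,3,4)] min show "\<rho> = \<tau> \<or> \<rho> = match \<tau>"
        using leD by blast
    qed (use \<tau> match[OF \<tau>(1)] in \<open>auto simp: K'_def\<close>)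
    moreover have "collapses T K' L"
    proof (rule less.hyps)
      show "card (K' - L) < card (K - L)"
        using \<tau>(1) fin by (intro psubset_card_mono) (auto simp: K'_def)
      show "finite K'" using less.prems(1) by (simp add: K'_def)
      show "L \<subseteq> K'" using less.prems(2) \<tau>(1) match[OF \<tau>(1)] by (auto simp: K'_def)
      have sub: "K' - L \<subseteq> K - L" "K' \<subseteq> K" by (auto simp: K'_def)
      show "match \<rho> \<in> K' - L \<and> match (match \<rho>) = \<rho> \<and> key (match \<rho>) = key \<rho>"
        if "\<rho> \<in> K' - L" for \<rho>
      proof -
        have "\<rho> \<in> K - L" using that sub by blast
        with match[of \<rho>] match[OF \<tau>(1)] that show ?thesis
          by (auto simp: K'_def)
      qed
      show "\<rho> \<in> faces T (match \<rho>) \<and> cell_dim T (match \<rho>) = cell_dim T \<rho> + 1 \<or>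
        match \<rho> \<in> faces T \<rho> \<and> cell_dim T \<rho> = cell_dim T (match \<rho>) + 1"
        if "\<rho> \<in> K' - L" for \<rho>
        using face[of \<rho>] that sub by blast
      show "\<rho>' = \<rho> \<or> \<rho>' = match \<rho> \<or> \<rho>' \<in> K' - L \<and> key \<rho>' < key \<rho>"
        if "\<rho> \<in> K' - L" "\<rho> \<in> faces T (match \<rho>)" "cell_dim T (match \<rho>) = cell_dim T \<rho> + 1"
          "\<rho>' \<in> K'" "\<rho> \<in> faces T \<rho>'" for \<rho> \<rho>'
        using decreasing[of \<rho> \<rho>'] that sub by (auto simp: K'_def)
    qed
    ultimately show ?thesis by (rule converse_rtranclp_into_rtranclp)
  qed
qed

section \<open>Faces in Hom complexes, and finiteness of \<open>winding_subcomplex\<close>\<close>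

lemma vertex_cell_in_faces_iff:
  "\<phi> \<in> extensional (pverts T) \<Longrightarrow> vertex_cell T \<phi> \<in> faces T \<sigma> \<longleftrightarrow> \<phi> \<in> cell_vertices T \<sigma>"
  by (auto simp: vertex_cell_def faces_def cell_vertices_def PiE_iff)

lemma face_in_hom_complex:
  assumes "pair_wf_digraph T" and "\<sigma> \<in> hom_complex T G" and "\<tau> \<in> faces T \<sigma>"
  shows "\<tau> \<in> hom_complex T G"
proof -
  have "\<tau> x \<times> \<tau> y \<subseteq> parcs G" if "(x, y) \<in> parcs T" for x y
  proof -
    have "x \<in> pverts T" "y \<in> pverts T"
      using pair_wf_digraph.wellformed'[OF assms(1) that] by auto
    then have "\<tau> x \<subseteq> \<sigma> x" "\<tau> y \<subseteq> \<sigma> y"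
      using assms(3) by (auto simp: faces_def PiE_iff)
    moreover have "\<sigma> x \<times> \<sigma> y \<subseteq> parcs G"
      using assms(2) that by (auto simp: hom_complex_def)
    ultimately show ?thesis by blast
  qed
  moreover have "\<tau> x \<subseteq> pverts G" if "x \<in> pverts T" for x
    using assms(2,3) that unfolding hom_complex_def faces_def PiE_iff by blast
  ultimately show ?thesis
    using assms(3) by (auto simp: hom_complex_def faces_def PiE_iff)
qed

lemma face_in_winding_subcomplex:
  assumes "m \<ge> 2" and "\<sigma> \<in> winding_subcomplex m n w" and "\<tau> \<in> faces (cycle_graph m) \<sigma>"
  shows "\<tau> \<in> winding_subcomplex m n w"
proof -
  interpret pair_graph "cycle_graph m" by (rule pair_graph_cycle_graph[OF assms(1)])
  have "cell_vertices (cycle_graph m) \<tau> \<subseteq> cell_vertices (cycle_graph m) \<sigma>"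
    using assms(3) by (auto simp: cell_vertices_def faces_def PiE_iff)
  with assms face_in_hom_complex[OF pair_wf_digraph_axioms] show ?thesis
    by (auto simp: winding_subcomplex_def)
qed

lemma finite_winding_subcomplex: "finite (winding_subcomplex m n w)"
proof (rule finite_subset)
  show "winding_subcomplex m n w \<subseteq> (\<Pi>\<^sub>E x\<in>{0..<m}. Pow {0..<n})"
    unfolding winding_subcomplex_def hom_complex_def cycle_graph_def
    by (auto simp: PiE_def Pi_def)
qed (auto intro!: finite_PiE)

section \<open>Integer division and linear congruences\<close>

lemma int_div_le_iff:
  fixes a b k :: int
  assumes "0 < k"
  shows "a div k \<le> b \<longleftrightarrow> a < k * (b + 1)"
proof
  assume "a div k \<le> b"
  then have "k * (a div k) \<le> k * b" using assms by simp
  moreover have "k * (a div k) + a mod k = a" "a mod k < k" using assms by simp_all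
  ultimately have "a < k * b + k" by linarith
  then show "a < k * (b + 1)" by (simp add: distrib_left)
next
  assume "a < k * (b + 1)"
  moreover have "k * (a div k) + a mod k = a" "0 \<le> a mod k" using assms by simp_all
  ultimately have "k * (a div k) < k * (b + 1)" by linarith
  then have "a div k < b + 1" using assms by (simp only: mult_less_cancel_left_pos)
  then show "a div k \<le> b" by simp
qed

text \<open>As \<open>a\<close> is invertible modulo \<open>k\<close>, the solutions form a single
  residue class modulo \<open>k\<close>, which meets each of the \<open>g\<close> blocks of length
  \<open>k\<close> once.\<close>

lemma card_linear_cong:
  fixes g k a u :: int
  assumes "0 < g" "0 < k" "coprime a k"
  shows "int (card {x \<in> {0..<g * k}. k dvd u + a * x}) = g"
proof -
  obtain y where "[a * y = 1] (mod k)" using cong_solve_coprime_int[OF assms(3)] by blast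
  then have y: "k dvd a * y - 1" by (simp add: cong_iff_dvd_diff)
  define x0 where "x0 = (- u * y) mod k"
  have x0: "0 \<le> x0" "x0 < k" using assms(2) by (auto simp: x0_def)
  have "k dvd u + a * x0"
  proof -
    have "- u * y - x0 = k * ((- u * y) div k)"
      unfolding x0_def by (rule minus_mod_eq_mult_div)
    then have "x0 - (- u * y) = k * - ((- u * y) div k)" by simp
    then have "k dvd x0 - (- u * y)" by (rule dvdI)
    then have "k dvd a * (x0 - (- u * y)) + - u * (a * y - 1)" using y by (intro dvd_add dvd_mult)
    moreover have "a * (x0 - (- u * y)) + - u * (a * y - 1) = u + a * x0"
      by (simp add: algebra_simps)
    ultimately show ?thesis by simp
  qed
  have iff: "k dvd u + a * x \<longleftrightarrow> k dvd x - x0" for x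
  proof -
    have "u + a * x = (u + a * x0) + a * (x - x0)" by (simp add: algebra_simps)
    then have "k dvd u + a * x \<longleftrightarrow> k dvd a * (x - x0)"
      using dvd_add_right_iff[OF \<open>k dvd u + a * x0\<close>] by (simp only:)
    also have "\<dots> \<longleftrightarrow> k dvd x - x0"
      using assms(3) by (simp add: coprime_dvd_mult_right_iff coprime_commute)
    finally show ?thesis .
  qed
  have "{x \<in> {0..<g * k}. k dvd u + a * x} = (\<lambda>j. x0 + k * j) ` {0..<g}"
  proof (intro equalityI subsetI)
    fix x assume "x \<in> {x \<in> {0..<g * k}. k dvd u + a * x}"
    then have x: "0 \<le> x" "x < g * k" "k dvd x - x0" by (auto simp: iff)
    then obtain j where j: "x - x0 = k * j" by (auto elim: dvdE)
    have "k * (-1) < k * j" using j x(1) x0(2) by simp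
    then have "- 1 < j" using assms(2) by (simp only: mult_less_cancel_left_pos)
    then have "0 \<le> j" by simp
    have "k * j < k * g" using j x(2) x0(1) by (simp add: mult.commute)
    then have "j < g" using assms(2) by (simp add: mult_less_cancel_left_pos)
    with \<open>0 \<le> j\<close> j show "x \<in> (\<lambda>j. x0 + k * j) ` {0..<g}"
      by (intro image_eqI[of _ _ j]) auto
  next
    fix x assume "x \<in> (\<lambda>j. x0 + k * j) ` {0..<g}"
    then obtain j where "j \<in> {0..<g}" and "x = x0 + k * j" by blast
    then have j: "x = x0 + k * j" "0 \<le> j" "j < g" by simp_all
    have "k * (j + 1) \<le> k * g" using j(3) assms(2) by (intro mult_left_mono) auto
    then have "x < g * k" using x0(2) j(1) by (simp add: algebra_simps)
    moreover have "0 \<le> x" using x0(1) j assms(2) by simp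
    ultimately show "x \<in> {x \<in> {0..<g * k}. k dvd u + a * x}"
      using j(1) by (simp add: iff)
  qed
  moreover have "inj_on (\<lambda>j. x0 + k * j) {0..<g}"
    using assms(2) by (intro inj_onI) simp
  ultimately show ?thesis using assms(1) by (simp add: card_image)
qed

section \<open>Lifting maps and cells to quasiperiodic functions on the integers\<close>

text \<open>
  \<open>C\<close> is a set of base points, one for each parity class of \<open>\<int>/n\<close> (which is all of \<open>\<int>/n\<close> for odd
  \<open>n\<close>), and \<open>p\<close> is the order of \<open>2\<close> in \<open>\<int>/n\<close>. Uniqueness of lifts of cells needs \<open>p \<ge> 3\<close>, which
  rules out \<open>n = 4\<close>.
\<close>

locale cycle_lift =
  fixes m n w s p :: int and C :: "int set"
  assumes m_ge: "m \<ge> 2" and n_ge: "n \<ge> 3" and p_ge: "p \<ge> 3"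
    and s_pos: "0 < s" and s_less: "s < m" and s_eq: "2 * s = m + n * w"
    and dvd_double_iff: "\<And>a. n dvd 2 * a \<longleftrightarrow> p dvd a"
    and C_unique: "\<And>c c' a. c \<in> C \<Longrightarrow> c' \<in> C \<Longrightarrow> n dvd c - c' + 2 * a \<Longrightarrow> c = c'"
    and C_exists: "\<And>y. \<exists>c\<in>C. \<exists>k. n dvd c + 2 * k - y"
begin

definition quasiperiodic :: "(int \<Rightarrow> int) \<Rightarrow> bool" where
  "quasiperiodic k \<longleftrightarrow> (\<forall>x. k (x + m) = k x + s)"

definition walk :: "(int \<Rightarrow> int) \<Rightarrow> bool" where
  "walk k \<longleftrightarrow> quasiperiodic k \<and> (\<forall>x. k x \<le> k (x + 1) \<and> k (x + 1) \<le> k x + 1)"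

text \<open>The inequalities are the worst cases that make every pointwise choice between
  \<open>lo\<close> and \<open>hi\<close> increase by 0 or 1 in each step. Combined, they force
  \<open>hi x \<le> lo x + 1\<close>, so every factor is a point or an edge.\<close>

definition interlaced :: "(int \<Rightarrow> int) \<Rightarrow> (int \<Rightarrow> int) \<Rightarrow> bool" where
  "interlaced lo hi \<longleftrightarrow> quasiperiodic lo \<and> quasiperiodic hi \<and>
     (\<forall>x. lo x \<le> hi x \<and> hi x \<le> lo (x + 1) \<and> hi (x + 1) \<le> lo x + 1)"

definition pos :: "int \<Rightarrow> (int \<Rightarrow> int) \<Rightarrow> int \<Rightarrow> int" where
  "pos c k x = (c - x + 2 * k x) mod n"

definition cell :: "int \<Rightarrow> (int \<Rightarrow> int) \<Rightarrow> (int \<Rightarrow> int) \<Rightarrow> int \<Rightarrow> int set" where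
  "cell c lo hi = (\<lambda>x\<in>{0..<m}. {pos c lo x, pos c hi x})"

lemma quasiperiodic_shift:
  assumes "quasiperiodic k"
  shows "k (x + m * j) = k x + s * j"
proof (induction j rule: int_induct[where k = 0])
  case (step1 i)
  have "k (x + m * i + m) = k (x + m * i) + s"
    using assms unfolding quasiperiodic_def by blast
  with step1 show ?case by (simp add: algebra_simps)
next
  case (step2 i)
  have "k (x + m * (i - 1) + m) = k (x + m * (i - 1)) + s"
    using assms unfolding quasiperiodic_def by blast
  with step2 show ?case by (simp add: algebra_simps)
qed simp

lemma quasiperiodic_mod: "quasiperiodic k \<Longrightarrow> k x = k (x mod m) + s * (x div m)"
  using quasiperiodic_shift[of k "x mod m" "x div m"] by (simp add: add.commute)

lemma pos_eq_iff: "pos c k x = pos c' k' x' \<longleftrightarrow> n dvd c - c' - (x - x') + 2 * (k x - k' x')"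
  unfolding pos_def mod_eq_dvd_iff by (simp add: algebra_simps)

text \<open>Going once around \<open>C_m\<close> changes \<open>c - x + 2 * k x\<close> by
  \<open>2 * s - m\<close>, which is \<open>n * w\<close> by \<open>s_eq\<close> and vanishes modulo
  \<open>n\<close>.\<close>

lemma pos_mod:
  assumes "quasiperiodic k"
  shows "pos c k (x mod m) = pos c k x"
proof -
  have "x mod m - x = - (m * (x div m))" by (simp add: minus_mod_eq_mult_div algebra_simps)
  moreover have "2 * (k (x mod m) - k x) = - (m + n * w) * (x div m)"
    using quasiperiodic_mod[OF assms, of x] unfolding s_eq[symmetric] by simp
  ultimately have "c - c - (x mod m - x) + 2 * (k (x mod m) - k x) = n * (- w * (x div m))"
    by (simp only:) (simp add: algebra_simps)
  then show ?thesis unfolding pos_eq_iff by (metis dvd_triv_left)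
qed

lemma pos_range: "pos c k x \<in> {0..<n}"
  using n_ge by (simp add: pos_def)

text \<open>The difference of the positions is \<open>2 * (l (x + 1) - k x) - 1\<close> modulo
  \<open>n\<close>; cancelling the factor 2 replaces \<open>n\<close> by \<open>p\<close>. Two
  functions are allowed so that different corners of a cell can be compared.\<close>

lemma pos_step:
  "[pos c l (x + 1) - pos c k x = 1] (mod n) \<longleftrightarrow> p dvd l (x + 1) - k x - 1"
  "[pos c l (x + 1) - pos c k x = -1] (mod n) \<longleftrightarrow> p dvd l (x + 1) - k x"
proof -
  have "[pos c l (x + 1) - pos c k x = 2 * (l (x + 1) - k x) - 1] (mod n)"
    unfolding pos_def cong_def mod_diff_eq by (simp add: algebra_simps)
  then have "[pos c l (x + 1) - pos c k x = a] (mod n) \<longleftrightarrow>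
      [2 * (l (x + 1) - k x) - 1 = a] (mod n)" for a
    unfolding cong_def by simp
  note this[of 1] this[of "- 1"]
  then show "[pos c l (x + 1) - pos c k x = 1] (mod n) \<longleftrightarrow> p dvd l (x + 1) - k x - 1"
    "[pos c l (x + 1) - pos c k x = -1] (mod n) \<longleftrightarrow> p dvd l (x + 1) - k x"
    using dvd_double_iff[of "l (x + 1) - k x"] dvd_double_iff[of "l (x + 1) - k x - 1"]
    by (simp_all add: cong_iff_dvd_diff right_diff_distrib)
qed

text \<open>Turns congruences of lifts into equalities: nearby lifts differ by at most 2, which is
  less than \<open>p\<close>.\<close>

lemma dvd_p_small: "p dvd a \<Longrightarrow> \<bar>a\<bar> \<le> 2 \<Longrightarrow> a = 0"
  using p_ge zdvd_not_zless[of "\<bar>a\<bar>" p] by fastforce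

lemma interlaced_bounds:
  assumes "interlaced lo hi"
  shows "lo x \<le> hi x" "hi x \<le> lo x + 1" "hi x \<le> lo (x + 1)" "hi (x + 1) \<le> lo x + 1"
    "hi (x - 1) \<le> lo x" "hi x \<le> lo (x - 1) + 1"
proof -
  have *: "lo y \<le> hi y" "hi y \<le> lo (y + 1)" "hi (y + 1) \<le> lo y + 1" for y
    using assms unfolding interlaced_def by auto
  show "lo x \<le> hi x" "hi x \<le> lo x + 1" "hi x \<le> lo (x + 1)" "hi (x + 1) \<le> lo x + 1"
    "hi (x - 1) \<le> lo x" "hi x \<le> lo (x - 1) + 1"
    using *[of x] *[of "x - 1"] by auto
qed

lemma interlaced_quasiperiodic:
  assumes "interlaced lo hi" shows "quasiperiodic lo" "quasiperiodic hi"
  using assms unfolding interlaced_def by auto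

lemma walk_between:
  assumes "interlaced lo hi" and "quasiperiodic k" and "\<And>x. lo x \<le> k x \<and> k x \<le> hi x"
  shows "walk k"
  unfolding walk_def
proof (intro conjI allI)
  fix x
  show "k x \<le> k (x + 1)" "k (x + 1) \<le> k x + 1"
    using interlaced_bounds[OF assms(1), of x] assms(3)[of x] assms(3)[of "x + 1"]
      interlaced_bounds(1)[OF assms(1), of "x + 1"] by linarith+
qed (rule assms(2))

lemma quasiperiodic_of_mod: "quasiperiodic (\<lambda>x. u (x mod m) + s * (x div m))"
  using m_ge by (auto simp: quasiperiodic_def algebra_simps)

text \<open>Lifts the vertices of a cell: \<open>\<phi>\<close> picks an end of the interval at each
  point of one period, and interlacing makes any such choice a walk.\<close>

lemma lift_choice:
  assumes "interlaced lo hi" and "\<phi> \<in> (\<Pi>\<^sub>E x\<in>{0..<m}. A x)"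
    and "\<And>x. x \<in> {0..<m} \<Longrightarrow> A x \<subseteq> {pos c lo x, pos c hi x}"
  obtains k where "walk k" "\<And>x. lo x \<le> k x \<and> k x \<le> hi x" "\<phi> = (\<lambda>x\<in>{0..<m}. pos c k x)"
proof -
  \<comment> \<open>Testing \<open>\<phi>\<close> at \<open>x mod m\<close> makes the choice
    periodic; \<open>lo\<close> is the default when both ends have the same position.\<close>
  define k where "k x = (if \<phi> (x mod m) = pos c lo (x mod m) then lo x else hi x)" for x
  have "quasiperiodic k"
    using interlaced_quasiperiodic[OF assms(1)] by (simp add: quasiperiodic_def k_def)
  moreover have between: "lo x \<le> k x \<and> k x \<le> hi x" for x
    using interlaced_bounds(1)[OF assms(1), of x] by (simp add: k_def)
  moreover have "\<phi> = (\<lambda>x\<in>{0..<m}. pos c k x)"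
  proof
    fix x
    show "\<phi> x = (\<lambda>x\<in>{0..<m}. pos c k x) x"
    proof (cases "x \<in> {0..<m}")
      case True
      then have "\<phi> x \<in> {pos c lo x, pos c hi x}"
        using assms(2,3) by (meson PiE_mem subsetD)
      then show ?thesis using True by (auto simp: k_def pos_def)
    next
      case False
      then show ?thesis using PiE_arb[OF assms(2)] by auto
    qed
  qed
  ultimately show ?thesis using that walk_between[OF assms(1)] by blast
qed

section \<open>Intervals of lifts are cells of winding number \<open>w\<close>\<close>

lemma cell_apply: "x \<in> {0..<m} \<Longrightarrow> cell c lo hi x = {pos c lo x, pos c hi x}"
  by (simp add: cell_def)

lemma cell_mod:
  assumes "interlaced lo hi"
  shows "cell c lo hi (x mod m) = {pos c lo x, pos c hi x}"
  using m_ge pos_mod[OF interlaced_quasiperiodic(1)[OF assms]]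
    pos_mod[OF interlaced_quasiperiodic(2)[OF assms]]
  by (simp add: cell_apply)

lemma parcs_mod:
  assumes "(x, y) \<in> parcs (cycle_graph m)"
  shows "x \<in> {0..<m}" "y \<in> {0..<m}" "y = (x + 1) mod m \<or> x = (y + 1) mod m"
  using assms m_ge by (auto simp: cycle_graph_def cong_def)

lemma parcs_cycle_iff:
  assumes "a \<in> {0..<n}" "b \<in> {0..<n}"
  shows "(a, b) \<in> parcs (cycle_graph n) \<longleftrightarrow> [b - a = 1] (mod n) \<or> [b - a = -1] (mod n)"
proof -
  have "b - (a + 1) = b - a - 1" "b - a - - 1 = - (a - (b + 1))" by simp_all
  then have "[b = a + 1] (mod n) \<longleftrightarrow> [b - a = 1] (mod n)"
    "[a = b + 1] (mod n) \<longleftrightarrow> [b - a = -1] (mod n)"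
    unfolding cong_iff_dvd_diff by (simp_all only: dvd_minus_iff)
  then show ?thesis using assms by (simp add: cycle_graph_def)
qed

lemma parcs_pos:
  assumes "k x \<le> l (x + 1)" and "l (x + 1) \<le> k x + 1"
  shows "(pos c k x, pos c l (x + 1)) \<in> parcs (cycle_graph n)"
proof -
  have "l (x + 1) - k x - 1 = 0 \<or> l (x + 1) - k x = 0" using assms by linarith
  then show ?thesis
    unfolding parcs_cycle_iff[OF pos_range pos_range] pos_step by (metis dvd_0_right)
qed

lemma parcs_cycle_sym: "(a, b) \<in> parcs (cycle_graph n) \<Longrightarrow> (b, a) \<in> parcs (cycle_graph n)"
  by (auto simp: cycle_graph_def)

lemma cell_in_hom_complex:
  assumes "interlaced lo hi"
  shows "cell c lo hi \<in> hom_complex (cycle_graph m) (cycle_graph n)"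
proof -
  \<comment> \<open>Arcs from \<open>x\<close> to \<open>x + 1\<close> suffice, including the one
    across the seam from \<open>m - 1\<close> to 0; the others follow by symmetry.\<close>
  have step: "cell c lo hi x \<times> cell c lo hi ((x + 1) mod m) \<subseteq> parcs (cycle_graph n)"
    if "x \<in> {0..<m}" for x
  proof -
    have "cell c lo hi x = {pos c lo x, pos c hi x}" using that by (rule cell_apply)
    moreover have "cell c lo hi ((x + 1) mod m) = {pos c lo (x + 1), pos c hi (x + 1)}"
      using assms by (rule cell_mod)
    moreover note interlaced_bounds[OF assms, of x] interlaced_bounds(1)[OF assms, of "x + 1"]
    ultimately show ?thesis by (auto intro!: parcs_pos)
  qed
  have "cell c lo hi x \<times> cell c lo hi y \<subseteq> parcs (cycle_graph n)"
    if "(x, y) \<in> parcs (cycle_graph m)" for x y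
    using parcs_mod[OF that] step[of x] step[of y] parcs_cycle_sym by blast
  moreover have "cell c lo hi \<in> (\<Pi>\<^sub>E x\<in>{0..<m}. Pow {0..<n} - {{}})"
    using pos_range by (auto simp: cell_def)
  ultimately show ?thesis by (auto simp: hom_complex_def cycle_graph_def)
qed

lemma walk_step_cong:
  assumes "walk k" and "x \<in> {0..<m}" and "\<phi> = (\<lambda>x\<in>{0..<m}. pos c k x)"
  shows "[\<phi> ((x + 1) mod m) - \<phi> x = 1] (mod n) \<longleftrightarrow> k (x + 1) = k x + 1"
    "[\<phi> ((x + 1) mod m) - \<phi> x = -1] (mod n) \<longleftrightarrow> k (x + 1) = k x"
proof -
  have k: "quasiperiodic k" "k x \<le> k (x + 1)" "k (x + 1) \<le> k x + 1"
    using assms(1) by (auto simp: walk_def)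
  have "\<phi> ((x + 1) mod m) = pos c k (x + 1)" "\<phi> x = pos c k x"
    using assms(2,3) m_ge pos_mod[OF k(1)] by auto
  moreover have "p dvd k (x + 1) - k x - 1 \<longleftrightarrow> k (x + 1) = k x + 1"
  proof
    assume "p dvd k (x + 1) - k x - 1"
    from dvd_p_small[OF this] k(2,3) show "k (x + 1) = k x + 1" by linarith
  qed simp
  moreover have "p dvd k (x + 1) - k x \<longleftrightarrow> k (x + 1) = k x"
  proof
    assume "p dvd k (x + 1) - k x"
    from dvd_p_small[OF this] k(2,3) show "k (x + 1) = k x" by linarith
  qed simp
  ultimately show "[\<phi> ((x + 1) mod m) - \<phi> x = 1] (mod n) \<longleftrightarrow> k (x + 1) = k x + 1"
    "[\<phi> ((x + 1) mod m) - \<phi> x = -1] (mod n) \<longleftrightarrow> k (x + 1) = k x"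
    using pos_step[of c k x k] by metis+
qed

lemma sum_steps: "0 \<le> a \<Longrightarrow> (\<Sum>x\<in>{0..<a}. k (x + 1) - k x) = k a - k 0" for k :: "int \<Rightarrow> int"
proof (induction a rule: int_ge_induct)
  case (step i)
  have "{0..<i + 1} = insert i {0..<i}" using step.hyps by auto
  with step show ?case by simp
qed simp

text \<open>The rise of \<open>k\<close> over one period is \<open>s\<close>, so there are
  \<open>s\<close> steps up and \<open>m - s\<close> steps down, and
  \<open>s - (m - s) = n * w\<close>.\<close>

lemma winding_number_walk:
  assumes "walk k"
  shows "hom_winding_number m n (\<lambda>x\<in>{0..<m}. pos c k x) = of_int w"
proof -
  let ?\<phi> = "\<lambda>x\<in>{0..<m}. pos c k x"
  let ?A = "{x \<in> {0..<m}. k (x + 1) = k x + 1}" and ?B = "{x \<in> {0..<m}. k (x + 1) = k x}"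
  have step: "k x \<le> k (x + 1)" "k (x + 1) \<le> k x + 1" for x
    using assms by (auto simp: walk_def)
  have sets: "{x \<in> {0..<m}. [?\<phi> ((x + 1) mod m) - ?\<phi> x = 1] (mod n)} = ?A"
    "{x \<in> {0..<m}. [?\<phi> ((x + 1) mod m) - ?\<phi> x = -1] (mod n)} = ?B"
    using walk_step_cong[OF assms _ refl, of _ c] by blast+
  have cardA: "int (card ?A) = s"
  proof -
    have "int (card ?A) = (\<Sum>x\<in>{0..<m}. if k (x + 1) = k x + 1 then 1 else 0)"
      by (simp add: sum.If_cases Int_def)
    also have "\<dots> = (\<Sum>x\<in>{0..<m}. k (x + 1) - k x)"
    proof (rule sum.cong)
      fix x
      show "(if k (x + 1) = k x + 1 then 1 else 0) = k (x + 1) - k x"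
        using step[of x] by auto
    qed simp
    also have "\<dots> = k (0 + m) - k 0" using sum_steps[of m k] m_ge by simp
    also have "k (0 + m) = k 0 + s"
      using assms unfolding walk_def quasiperiodic_def by blast
    finally show ?thesis by simp
  qed
  have cardB: "int (card ?B) = m - int (card ?A)"
  proof -
    have "x \<in> ?A \<union> ?B" if "x \<in> {0..<m}" for x using step[of x] that by auto
    then have "?A \<union> ?B = {0..<m}" by blast
    moreover have "finite ?A" "finite ?B" by (rule finite_subset[of _ "{0..<m}"]; auto)+
    then have "card (?A \<union> ?B) = card ?A + card ?B" by (rule card_Un_disjoint) auto
    ultimately have "card ?A + card ?B = nat m" by simp
    then show ?thesis using m_ge by linarith
  qed
  have "hom_winding_number m n ?\<phi> = (of_int (int (card ?A)) - of_int (int (card ?B))) / of_int n"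
    unfolding hom_winding_number_def sets of_int_of_nat_eq ..
  also have "\<dots> = (of_int s - of_int (m - s)) / of_int n"
    unfolding cardB cardA ..
  also have "\<dots> = of_int (n * w) / of_int n" using s_eq by (simp flip: of_int_diff)
  finally show ?thesis using n_ge by simp
qed

lemma cell_in_winding_subcomplex:
  assumes "interlaced lo hi"
  shows "cell c lo hi \<in> winding_subcomplex m n w"
  unfolding winding_subcomplex_def
proof (intro CollectI conjI ballI)
  fix \<phi> assume "\<phi> \<in> cell_vertices (cycle_graph m) (cell c lo hi)"
  then have "\<phi> \<in> (\<Pi>\<^sub>E x\<in>{0..<m}. cell c lo hi x)"
    by (simp add: cell_vertices_def cycle_graph_def)
  then obtain k where "walk k" "\<phi> = (\<lambda>x\<in>{0..<m}. pos c k x)"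
    by (rule lift_choice[OF assms, of _ _ c]) (auto simp: cell_apply)
  then show "hom_winding_number m n \<phi> = of_int w"
    using winding_number_walk by simp
qed (rule cell_in_hom_complex[OF assms])

section \<open>Existence of lifts of maps and of cells\<close>

text \<open>An arc determines the increment only as 0 or 1 modulo \<open>p\<close>; the range from
  -1 to 2 is the one in which \<open>dvd_p_small\<close> settles both cases.\<close>

lemma adjacent_small:
  assumes "(pos c k x, pos c l (x + 1)) \<in> parcs (cycle_graph n)"
    and "-1 \<le> l (x + 1) - k x" "l (x + 1) - k x \<le> 2"
  shows "k x \<le> l (x + 1) \<and> l (x + 1) \<le> k x + 1"
proof -
  have "p dvd l (x + 1) - k x - 1 \<or> p dvd l (x + 1) - k x"
    using assms(1) unfolding parcs_cycle_iff[OF pos_range pos_range] pos_step .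
  then show ?thesis
  proof
    assume "p dvd l (x + 1) - k x - 1"
    from dvd_p_small[OF this] assms(2,3) show ?thesis by linarith
  next
    assume "p dvd l (x + 1) - k x"
    from dvd_p_small[OF this] assms(2,3) show ?thesis by linarith
  qed
qed

text \<open>\<open>pos\<close> evaluates its function only at \<open>x\<close>, so the constant
  functions merely name the two possible lifted values of a neighbour.\<close>

lemma adjacent_pos:
  assumes "(a, pos c l (x + 1)) \<in> parcs (cycle_graph n)"
  shows "a = pos c (\<lambda>_. l (x + 1)) x \<or> a = pos c (\<lambda>_. l (x + 1) - 1) x"
proof -
  have a: "a \<in> {0..<n}" using assms by (auto simp: cycle_graph_def)
  have "[pos c l (x + 1) - a = 1] (mod n) \<or> [pos c l (x + 1) - a = -1] (mod n)"
    using assms parcs_cycle_iff[OF a pos_range] by blast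
  \<comment> \<open>\<open>d\<close> is the increment of the lift: 1 for a step up and 0 for a step
    down.\<close>
  moreover have "a = pos c (\<lambda>_. l (x + 1) - d) x"
    if "[pos c l (x + 1) - a = 2 * d - 1] (mod n)" for d
  proof -
    have "[a = pos c l (x + 1) - (2 * d - 1)] (mod n)"
      using cong_diff[OF cong_refl[of "pos c l (x + 1)" n] that] by simp
    also have "[pos c l (x + 1) - (2 * d - 1) = pos c (\<lambda>_. l (x + 1) - d) x] (mod n)"
      unfolding pos_def cong_def
      by (simp only: mod_diff_left_eq mod_mod_trivial) (simp add: algebra_simps)
    finally show ?thesis using a pos_range[of c "\<lambda>_. l (x + 1) - d" x] by (simp add: cong_def)
  qed
  note this[of 1] this[of 0]
  ultimately show ?thesis by auto
qed

text \<open>Path lifting: \<open>c\<close> and \<open>k0\<close> lift the value at 0, the steps are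
  added up along one period, and the winding number ensures that the total rise is \<open>s\<close>,
  so that the sum extends quasiperiodically.\<close>

lemma walk_lift:
  assumes "\<phi> \<in> graph_homs (cycle_graph m) (cycle_graph n)"
    and "hom_winding_number m n \<phi> = of_int w"
  obtains c k where "c \<in> C" "walk k" "\<phi> = (\<lambda>x\<in>{0..<m}. pos c k x)"
proof -
  obtain c k0 where c: "c \<in> C" and k0: "n dvd c + 2 * k0 - \<phi> 0"
    using C_exists by blast
  have \<phi>_ext: "\<phi> \<in> extensional {0..<m}" and \<phi>_range: "x \<in> {0..<m} \<Longrightarrow> \<phi> x \<in> {0..<n}" for x
    using assms(1) by (auto simp: graph_homs_def cycle_graph_def PiE_iff)
  have step: "[\<phi> ((x + 1) mod m) - \<phi> x = 1] (mod n) \<or> [\<phi> ((x + 1) mod m) - \<phi> x = -1] (mod n)"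
    if x: "x \<in> {0..<m}" for x
  proof -
    have "(x + 1) mod m \<in> {0..<m}" using m_ge by simp
    then have "(x, (x + 1) mod m) \<in> parcs (cycle_graph m)"
      using x by (auto simp: cycle_graph_def cong_def)
    then have "(\<phi> x, \<phi> ((x + 1) mod m)) \<in> parcs (cycle_graph n)"
      using assms(1) by (auto simp: graph_homs_def)
    then show ?thesis
      using parcs_cycle_iff \<phi>_range x \<open>(x + 1) mod m \<in> {0..<m}\<close> by blast
  qed
  define \<delta> :: "int \<Rightarrow> int" where
    "\<delta> x = (if [\<phi> ((x + 1) mod m) - \<phi> x = 1] (mod n) then 1 else 0)" for x
  have step_\<delta>: "[\<phi> ((x + 1) mod m) - \<phi> x = 2 * \<delta> x - 1] (mod n)" if "x \<in> {0..<m}" for x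
    using step[OF that] by (auto simp: \<delta>_def)
  have sum_\<delta>: "(\<Sum>x\<in>{0..<m}. \<delta> x) = s"
  proof -
    let ?P = "\<lambda>x. [\<phi> ((x + 1) mod m) - \<phi> x = 1] (mod n)"
    let ?A = "{x \<in> {0..<m}. ?P x}"
    let ?B = "{x \<in> {0..<m}. [\<phi> ((x + 1) mod m) - \<phi> x = -1] (mod n)}"
    \<comment> \<open>Since \<open>n \<ge> 3\<close>, steps up and steps down are distinct. Their
      numbers have sum \<open>m\<close> and difference \<open>n * w\<close>, so there are
      \<open>s\<close> steps up.\<close>
    have "\<not> n dvd 2" using n_ge zdvd_not_zless[of 2 n] by simp
    then have "\<not> [1 = -1] (mod n)" by (simp add: cong_iff_dvd_diff)
    then have "?A \<inter> ?B = {}" using cong_trans cong_sym by blast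
    moreover have "?A \<union> ?B = {0..<m}" using step by blast
    ultimately have "card ?A + card ?B = card {0..<m}"
      using card_Un_disjoint[of ?A ?B] by (metis (lifting) finite_Un finite_atLeastLessThan_int)
    then have AB: "int (card ?A) + int (card ?B) = m" using m_ge by simp
    have "(of_int (int (card ?A) - int (card ?B)) :: rat) / of_int n = of_int w"
      using assms(2) by (simp add: hom_winding_number_def)
    then have "(of_int (int (card ?A) - int (card ?B)) :: rat) = of_int (n * w)"
      using n_ge by (simp add: field_simps)
    then have "int (card ?A) - int (card ?B) = n * w" using of_int_eq_iff by blast
    then have "int (card ?A) = s" using AB s_eq by linarith
    then show ?thesis by (simp add: \<delta>_def sum.If_cases Int_def)
  qed
  define u where "u x = k0 + (\<Sum>i\<in>{0..<x}. \<delta> i)" for x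
  define k where "k x = u (x mod m) + s * (x div m)" for x
  have quasi: "quasiperiodic k" unfolding k_def by (rule quasiperiodic_of_mod)
  have u_step: "u (x + 1) = u x + \<delta> x" if "0 \<le> x" for x
  proof -
    have "{0..<x + 1} = insert x {0..<x}" using that by auto
    then show ?thesis by (simp add: u_def)
  qed
  have k_eq: "k x = u x" if "0 \<le> x" "x < m" for x
    using that by (simp add: k_def)
  have k_step: "k (x + 1) = k x + \<delta> x" if "x \<in> {0..<m}" for x
  proof (cases "x + 1 = m")
    \<comment> \<open>The seam: here \<open>k m\<close> is by definition \<open>k0 + s\<close>,
      which agrees with the running sum by \<open>sum_\<delta>\<close>.\<close>
    case True
    then have "k (x + 1) = u m" using m_ge sum_\<delta> by (simp add: k_def u_def)
    then show ?thesis using True u_step[of x] k_eq[of x] that by simp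
  qed (use that u_step k_eq[of x] k_eq[of "x + 1"] in auto)
  have "walk k"
    unfolding walk_def
  proof (intro conjI allI)
    fix x
    have "x mod m \<in> {0..<m}" using m_ge by simp
    then have "k (x mod m + 1) = k (x mod m) + \<delta> (x mod m)" by (rule k_step)
    moreover have "k (x + 1) = k (x mod m + 1) + s * (x div m)"
      using quasiperiodic_shift[OF quasi, of "x mod m + 1" "x div m"]
      by (simp add: algebra_simps)
    ultimately have "k (x + 1) = k x + \<delta> (x mod m)"
      using quasiperiodic_mod[OF quasi, of x] by simp
    then show "k x \<le> k (x + 1)" "k (x + 1) \<le> k x + 1" by (simp_all add: \<delta>_def)
  qed (rule quasi)
  moreover have "\<phi> x = pos c k x" if "0 \<le> x" "x < m" for x
    using that
  proof (induction x rule: int_ge_induct)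
    case base
    have "k 0 = k0" using m_ge by (simp add: k_def u_def)
    then have "pos c k 0 = \<phi> 0 mod n"
      using k0 by (simp add: pos_def mod_eq_dvd_iff)
    then show ?case using \<phi>_range[of 0] m_ge by simp
  next
    case (step x)
    have x: "x \<in> {0..<m}" "x + 1 \<in> {0..<m}" using step by auto
    have "[\<phi> (x + 1) = \<phi> x + (2 * \<delta> x - 1)] (mod n)"
      using cong_add[OF step_\<delta>[OF x(1)] cong_refl[of "\<phi> x"]] x by (simp add: add.commute)
    also have "\<phi> x = pos c k x" using step by simp
    also have "[pos c k x + (2 * \<delta> x - 1) = pos c k (x + 1)] (mod n)"
      unfolding pos_def cong_def k_step[OF x(1)]
      by (simp only: mod_add_left_eq mod_mod_trivial) (simp add: algebra_simps)
    finally show ?case using \<phi>_range[OF x(2)] pos_range[of c k "x + 1"] by (simp add: cong_def)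
  qed
  then have "\<phi> = (\<lambda>x\<in>{0..<m}. pos c k x)"
    by (intro extensionalityI[OF \<phi>_ext restrict_extensional]) simp
  ultimately show ?thesis by (rule that[OF c])
qed

text \<open>One vertex of \<sigma> is lifted to a walk \<open>k\<close>. The elements of each factor
  are adjacent to the position of \<open>k\<close> at the next point, so they lift to
  \<open>k\<close> moved by -1, 0 or 1, and the extreme lifts bound the interval.\<close>

lemma cell_lift:
  assumes "\<sigma> \<in> winding_subcomplex m n w"
  obtains c lo hi where "c \<in> C" "interlaced lo hi" "\<sigma> = cell c lo hi"
proof -
  have \<sigma>: "\<sigma> \<in> hom_complex (cycle_graph m) (cycle_graph n)"
    using assms by (simp add: winding_subcomplex_def)
  have \<sigma>_ext: "\<sigma> \<in> extensional {0..<m}"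
    and \<sigma>_ne: "x \<in> {0..<m} \<Longrightarrow> \<sigma> x \<noteq> {}"
    and \<sigma>_range: "x \<in> {0..<m} \<Longrightarrow> \<sigma> x \<subseteq> {0..<n}" for x
  proof -
    have \<sigma>': "\<sigma> \<in> (\<Pi>\<^sub>E x\<in>{0..<m}. Pow {0..<n} - {{}})"
      using \<sigma> by (simp add: hom_complex_def cycle_graph_def)
    then show "\<sigma> \<in> extensional {0..<m}" by (simp add: PiE_iff)
    show "\<sigma> x \<noteq> {}" "\<sigma> x \<subseteq> {0..<n}" if "x \<in> {0..<m}"
      using PiE_mem[OF \<sigma>' that] by auto
  qed
  have hom: "\<sigma> x \<times> \<sigma> y \<subseteq> parcs (cycle_graph n)" if "(x, y) \<in> parcs (cycle_graph m)" for x y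
    using \<sigma> that unfolding hom_complex_def by blast
  have edge: "(a, b) \<in> parcs (cycle_graph n)"
    if "a \<in> \<sigma> (x mod m)" "b \<in> \<sigma> ((x + 1) mod m)" for a b x
  proof -
    have "(x mod m, (x + 1) mod m) \<in> parcs (cycle_graph m)"
      using m_ge by (auto simp: cycle_graph_def cong_def mod_simps)
    from hom[OF this] that show ?thesis by blast
  qed
  define \<phi> where "\<phi> = (\<lambda>x\<in>{0..<m}. SOME a. a \<in> \<sigma> x)"
  have \<phi>_in: "\<phi> x \<in> \<sigma> x" if "x \<in> {0..<m}" for x
    using \<sigma>_ne[OF that] that by (auto simp: \<phi>_def some_in_eq)
  have \<phi>_vert: "\<phi> \<in> cell_vertices (cycle_graph m) \<sigma>"
    unfolding cell_vertices_def PiE_iff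
    using \<phi>_in by (simp add: cycle_graph_def) (simp add: \<phi>_def)
  have "\<phi> \<in> graph_homs (cycle_graph m) (cycle_graph n)"
  proof -
    have "(\<phi> x, \<phi> y) \<in> parcs (cycle_graph n)" if "(x, y) \<in> parcs (cycle_graph m)" for x y
      using hom[OF that] parcs_mod[OF that] \<phi>_in[of x] \<phi>_in[of y] by blast
    moreover have "\<phi> x \<in> {0..<n}" if "x \<in> {0..<m}" for x
      using \<phi>_in[OF that] \<sigma>_range[OF that] by blast
    then have "\<phi> \<in> (\<Pi>\<^sub>E x\<in>{0..<m}. {0..<n})"
      unfolding PiE_iff by (simp add: \<phi>_def)
    ultimately show ?thesis by (auto simp: graph_homs_def cycle_graph_def)
  qed
  moreover have "hom_winding_number m n \<phi> = of_int w"
    using assms \<phi>_vert by (simp add: winding_subcomplex_def)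
  ultimately obtain c k where c: "c \<in> C" and k: "walk k" and \<phi>k: "\<phi> = (\<lambda>x\<in>{0..<m}. pos c k x)"
    by (rule walk_lift)
  have quasi: "quasiperiodic k" and k_step: "k x \<le> k (x + 1)" "k (x + 1) \<le> k x + 1" for x
    using k by (auto simp: walk_def)
  have k_in: "pos c k x \<in> \<sigma> (x mod m)" for x
    using \<phi>_in[of "x mod m"] m_ge pos_mod[OF quasi] by (simp add: \<phi>k)
  \<comment> \<open>\<open>ext (-1)\<close> and \<open>ext 1\<close> move \<open>k\<close> down or
    up wherever the factor contains the moved position.\<close>
  define ext where "ext d x = (if pos c (\<lambda>x. k x + d) x \<in> \<sigma> (x mod m) then k x + d else k x)" for d x
  have ext_quasi: "quasiperiodic (ext d)" for d
    unfolding quasiperiodic_def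
  proof
    fix x
    have "quasiperiodic (\<lambda>x. k x + d)" using quasi by (simp add: quasiperiodic_def)
    from pos_mod[OF this, of c x] pos_mod[OF this, of c "x + m"]
    have "pos c (\<lambda>x. k x + d) (x + m) = pos c (\<lambda>x. k x + d) x" by simp
    then show "ext d (x + m) = ext d x + s"
      using quasi by (simp add: ext_def quasiperiodic_def)
  qed
  have ext_in: "pos c (ext d) x \<in> \<sigma> (x mod m)" for d x
    using k_in[of x] by (auto simp: ext_def pos_def)
  have ext_le: "\<bar>ext d x - k x\<bar> \<le> \<bar>d\<bar>" for d x by (simp add: ext_def)
  have sgn: "ext (-1) x \<le> k x" "k x \<le> ext 1 x" for x by (simp_all add: ext_def)
  \<comment> \<open>Comparing with \<open>k\<close> first brings the increments between
    \<open>ext (-1)\<close> and \<open>ext 1\<close> into the range of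
    \<open>adjacent_small\<close>.\<close>
  have step1: "ext d x \<le> k (x + 1) \<and> k (x + 1) \<le> ext d x + 1" if "\<bar>d\<bar> = 1" for d x
    by (rule adjacent_small[OF edge[OF ext_in k_in]]) (use ext_le[of d x] k_step[of x] that in auto)
  have "interlaced (ext (-1)) (ext 1)"
    unfolding interlaced_def
  proof (intro conjI allI)
    fix x
    have "ext 1 x \<le> ext (-1) (x + 1) \<and> ext (-1) (x + 1) \<le> ext 1 x + 1"
      by (rule adjacent_small[OF edge[OF ext_in ext_in]])
        (use step1[of 1 x] ext_le[of "-1" "x + 1"] sgn[of "x + 1"] in auto)
    then show "ext 1 x \<le> ext (-1) (x + 1)" by blast
    have "ext (-1) x \<le> ext 1 (x + 1) \<and> ext 1 (x + 1) \<le> ext (-1) x + 1"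
      by (rule adjacent_small[OF edge[OF ext_in ext_in]])
        (use step1[of "-1" x] ext_le[of 1 "x + 1"] sgn[of "x + 1"] in auto)
    then show "ext 1 (x + 1) \<le> ext (-1) x + 1" by blast
    show "ext (-1) x \<le> ext 1 x" using sgn[of x] by linarith
  qed (rule ext_quasi)+
  moreover have "\<sigma> = cell c (ext (-1)) (ext 1)"
  proof
    fix x
    show "\<sigma> x = cell c (ext (-1)) (ext 1) x"
    proof (cases "x \<in> {0..<m}")
      case True
      then have xm: "x mod m = x" by simp
      have "a \<in> {pos c (ext (-1)) x, pos c (ext 1) x}" if a: "a \<in> \<sigma> x" for a
      proof -
        have "(a, pos c k (x + 1)) \<in> parcs (cycle_graph n)"
          using edge[of a x] a k_in xm by auto
        from adjacent_pos[OF this] k_step[of x]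
        \<comment> \<open>Both candidates have lifts within 1 of \<open>k x\<close>, because
          \<open>k\<close> rises by 0 or 1 from \<open>x\<close> to \<open>x + 1\<close>.\<close>
        have "\<exists>d\<in>{-1, 0, 1}. a = pos c (\<lambda>x. k x + d) x"
        proof (elim disjE)
          assume *: "a = pos c (\<lambda>_. k (x + 1)) x"
          show ?thesis
            by (rule bexI[of _ "k (x + 1) - k x"]) (use * k_step[of x] in \<open>auto simp: pos_def\<close>)
        next
          assume *: "a = pos c (\<lambda>_. k (x + 1) - 1) x"
          show ?thesis
            by (rule bexI[of _ "k (x + 1) - 1 - k x"]) (use * k_step[of x] in \<open>auto simp: pos_def\<close>)
        qed
        then obtain d where d: "d \<in> {-1, 0, 1}" "a = pos c (\<lambda>x. k x + d) x" by blast
        have ad: "a = pos c (ext d) x"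
          using d(2) a xm by (auto simp: ext_def pos_def)
        show ?thesis
        proof (cases "d = 0")
          case True
          \<comment> \<open>\<open>k x\<close> lies in an interval of length at most 1, so it is one
            of the ends.\<close>
          have "k x = ext (-1) x \<or> k x = ext 1 x"
            using interlaced_bounds(1,2)[OF \<open>interlaced (ext (-1)) (ext 1)\<close>, of x] sgn[of x]
            by linarith
          with True d(2) show ?thesis by (auto simp: pos_def)
        qed (use d(1) ad in auto)
      qed
      moreover have "{pos c (ext (-1)) x, pos c (ext 1) x} \<subseteq> \<sigma> x"
        using ext_in[of _ x] xm by auto
      ultimately show ?thesis using True by (auto simp: cell_apply)
    next
      case False
      then show ?thesis using \<sigma>_ext by (auto simp: cell_def extensional_def)
    qed
  qed
  ultimately show ?thesis by (rule that[OF c])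
qed

section \<open>Uniqueness of lifts, and the face relation in terms of intervals\<close>

text \<open>The base points agree by \<open>C_unique\<close>. Then \<open>k x - l x\<close> is a
  multiple of \<open>p\<close> that changes by at most 1 in a step, hence not at all.\<close>

lemma walks_eq:
  assumes "walk k" "walk l" "c \<in> C" "c' \<in> C" "\<And>x. x \<in> {0..<m} \<Longrightarrow> pos c k x = pos c' l x"
  shows "c = c'" "\<exists>e. \<forall>x. k x = l x + p * e"
proof -
  have quasi: "quasiperiodic k" "quasiperiodic l" using assms(1,2) by (auto simp: walk_def)
  have "pos c k x = pos c' l x" for x
    using pos_mod[OF quasi(1), of c x] pos_mod[OF quasi(2), of c' x] assms(5)[of "x mod m"] m_ge
    by simp
  then have *: "n dvd c - c' + 2 * (k x - l x)" for x
    unfolding pos_eq_iff by simp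
  then show "c = c'" using C_unique assms(3,4) by blast
  with * have even: "n dvd 2 * (k x - l x)" for x by (simp only: diff_self add_0)
  have dvd: "p dvd k x - l x" for x by (rule iffD1[OF dvd_double_iff even])
  have "k (x + 1) - l (x + 1) = k x - l x" for x
  proof -
    have "p dvd (k (x + 1) - l (x + 1)) - (k x - l x)" using dvd[of "x + 1"] dvd[of x] by (rule dvd_diff)
    moreover have "k x \<le> k (x + 1)" "k (x + 1) \<le> k x + 1" "l x \<le> l (x + 1)" "l (x + 1) \<le> l x + 1"
      using assms(1,2) by (auto simp: walk_def)
    ultimately show ?thesis
      using dvd_p_small[of "(k (x + 1) - l (x + 1)) - (k x - l x)"] by linarith
  qed
  note step = this
  have const: "k x - l x = k 0 - l 0" for x
  proof (induction x rule: int_induct[where k = 0])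
    case (step1 i) then show ?case using step[of i] by simp
  next
    case (step2 i) then show ?case using step[of "i - 1"] by simp
  qed simp
  obtain e where "k 0 - l 0 = p * e" using dvd[of 0] by (auto elim: dvdE)
  with const have "\<forall>x. k x = l x + p * e" by (metis add.commute diff_add_cancel)
  then show "\<exists>e. \<forall>x. k x = l x + p * e" ..
qed

text \<open>The walks \<open>lo\<close> and \<open>hi\<close> are vertices of the larger cell, so
  each of them fits into the larger interval after a translation. The two translations agree, since
  both intervals have length at most 1.\<close>

lemma cell_in_faces_iff:
  assumes "interlaced lo hi" "interlaced lo' hi'" "c \<in> C" "c' \<in> C"
  shows "cell c lo hi \<in> faces (cycle_graph m) (cell c' lo' hi') \<longleftrightarrow>
    c = c' \<and> (\<exists>e. \<forall>x. lo' x + p * e \<le> lo x \<and> hi x \<le> hi' x + p * e)"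
proof
  assume "cell c lo hi \<in> faces (cycle_graph m) (cell c' lo' hi')"
  then have sub: "{pos c lo x, pos c hi x} \<subseteq> {pos c' lo' x, pos c' hi' x}" if "x \<in> {0..<m}" for x
    using that unfolding faces_def by (auto simp: PiE_iff cycle_graph_def cell_apply)
  have walks: "walk lo" "walk hi"
    using walk_between[OF assms(1)] interlaced_quasiperiodic[OF assms(1)]
      interlaced_bounds(1)[OF assms(1)] by auto
  have ex: "\<exists>k e. c = c' \<and> (\<forall>x. lo' x \<le> k x \<and> k x \<le> hi' x) \<and> (\<forall>x. l x = k x + p * e)"
    if l: "walk l" "\<And>x. x \<in> {0..<m} \<Longrightarrow> pos c l x \<in> {pos c lo x, pos c hi x}" for l
  proof -
    have "pos c l x \<in> {pos c' lo' x, pos c' hi' x}" if "x \<in> {0..<m}" for x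
      using sub[OF that] l(2)[OF that] by blast
    then have "(\<lambda>x\<in>{0..<m}. pos c l x) \<in> (\<Pi>\<^sub>E x\<in>{0..<m}. {pos c' lo' x, pos c' hi' x})"
      by simp
    then obtain k where k: "walk k" "\<And>x. lo' x \<le> k x \<and> k x \<le> hi' x"
      "(\<lambda>x\<in>{0..<m}. pos c l x) = (\<lambda>x\<in>{0..<m}. pos c' k x)"
      by (rule lift_choice[OF assms(2), of _ _ c']) auto
    have "pos c l x = pos c' k x" if "x \<in> {0..<m}" for x
      using fun_cong[OF k(3), of x] that by simp
    with walks_eq[OF l(1) k(1) assms(3,4)] k(2) show ?thesis by blast
  qed
  obtain k1 e1 where 1: "c = c'" "\<forall>x. lo' x \<le> k1 x \<and> k1 x \<le> hi' x" "\<forall>x. lo x = k1 x + p * e1"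
    using ex[OF walks(1)] by auto
  obtain k2 e2 where 2: "\<forall>x. lo' x \<le> k2 x \<and> k2 x \<le> hi' x" "\<forall>x. hi x = k2 x + p * e2"
    using ex[OF walks(2)] by auto
  have "p * (e1 - e2) = (lo 0 - hi 0) - (k1 0 - k2 0)"
    using 1 2 by (simp add: algebra_simps)
  moreover have "\<bar>(lo 0 - hi 0) - (k1 0 - k2 0)\<bar> \<le> 2"
    using spec[OF 1(2), of 0] spec[OF 2(1), of 0] interlaced_bounds(1,2)[OF assms(1), of 0]
      interlaced_bounds(1,2)[OF assms(2), of 0]
    by linarith
  ultimately have "p * (e1 - e2) = 0" using dvd_p_small[OF dvd_triv_left] by metis
  then have "e1 = e2" using p_ge by simp
  with 1 2 have "\<forall>x. lo' x + p * e1 \<le> lo x \<and> hi x \<le> hi' x + p * e1" by simp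
  with 1(1) show "c = c' \<and> (\<exists>e. \<forall>x. lo' x + p * e \<le> lo x \<and> hi x \<le> hi' x + p * e)"
    by blast
next
  assume "c = c' \<and> (\<exists>e. \<forall>x. lo' x + p * e \<le> lo x \<and> hi x \<le> hi' x + p * e)"
  then obtain e where e: "c = c'" "\<forall>x. lo' x + p * e \<le> lo x \<and> hi x \<le> hi' x + p * e" by blast
  \<comment> \<open>After translation, a value of the smaller interval lies in the larger one and is
    one of its ends, whose distance is at most 1.\<close>
  have *: "pos c k x \<in> {pos c lo' x, pos c hi' x}" if "lo x \<le> k x" "k x \<le> hi x" for k x
  proof -
    have "pos c k x = pos c (\<lambda>x. k x - p * e) x"
      unfolding pos_eq_iff using dvd_double_iff[of "p * e"] by simp
    moreover have "k x - p * e = lo' x \<or> k x - p * e = hi' x"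
      using that spec[OF e(2), of x] interlaced_bounds(2)[OF assms(2), of x] by linarith
    then have "pos c (\<lambda>x. k x - p * e) x \<in> {pos c lo' x, pos c hi' x}"
      unfolding pos_def by (elim disjE) (simp_all only: insert_iff simp_thms)
    ultimately show ?thesis by simp
  qed
  have "pos c lo x \<in> {pos c lo' x, pos c hi' x}" "pos c hi x \<in> {pos c lo' x, pos c hi' x}" for x
    using *[of x lo] *[of x hi] interlaced_bounds(1)[OF assms(1), of x] by auto
  with e(1) show "cell c lo hi \<in> faces (cycle_graph m) (cell c' lo' hi')"
    by (auto simp: faces_def PiE_iff cycle_graph_def cell_def)
qed

lemma cell_eq_iff:
  assumes "interlaced lo hi" "interlaced lo' hi'" "c \<in> C" "c' \<in> C"
  shows "cell c lo hi = cell c' lo' hi' \<longleftrightarrow>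
    c = c' \<and> (\<exists>e. \<forall>x. lo x = lo' x + p * e \<and> hi x = hi' x + p * e)"
proof
  have refl: "cell c' lo' hi' \<in> faces (cycle_graph m) (cell c' lo' hi')"
    by (auto simp: faces_def cell_def cycle_graph_def)
  assume eq: "cell c lo hi = cell c' lo' hi'"
  from cell_in_faces_iff[OF assms] refl eq obtain e where
    e: "c = c'" "\<And>x. lo' x + p * e \<le> lo x \<and> hi x \<le> hi' x + p * e" by auto
  from cell_in_faces_iff[OF assms(2,1,4,3)] refl eq obtain e' where
    e': "\<And>x. lo x + p * e' \<le> lo' x \<and> hi' x \<le> hi x + p * e'" by auto
  \<comment> \<open>The lower ends give the first inequality and the upper ends the second, so the
    two translations are opposite.\<close>
  have "p * e' \<le> - (p * e)" "- (p * e) \<le> p * e'" using e(2)[of 0] e'[of 0] by linarith+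
  then have "p * e' = - (p * e)" by simp
  then have "lo x = lo' x + p * e \<and> hi x = hi' x + p * e" for x
    using e(2)[of x] e'[of x] by linarith
  with e(1) show "c = c' \<and> (\<exists>e. \<forall>x. lo x = lo' x + p * e \<and> hi x = hi' x + p * e)" by blast
next
  assume "c = c' \<and> (\<exists>e. \<forall>x. lo x = lo' x + p * e \<and> hi x = hi' x + p * e)"
  then obtain e where e: "c = c'" "\<forall>x. lo x = lo' x + p * e \<and> hi x = hi' x + p * e" by blast
  have "pos c lo x = pos c lo' x" "pos c hi x = pos c hi' x" for x
    unfolding pos_eq_iff using e(2) dvd_double_iff[of "p * e"] by simp_all
  with e(1) show "cell c lo hi = cell c' lo' hi'" by (simp add: cell_def)
qed

section \<open>Levels, the switching point and the key\<close>

text \<open>Deviation of \<open>k\<close> from the line of slope \<open>s / m\<close>, multiplied by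
  \<open>m\<close> to remain an integer. It is periodic for quasiperiodic \<open>k\<close>, so its
  extrema over one period are global.\<close>

definition level :: "(int \<Rightarrow> int) \<Rightarrow> int \<Rightarrow> int" where
  "level k x = m * k x - s * x"

definition low :: "(int \<Rightarrow> int) \<Rightarrow> int" where
  "low k = Min (level k ` {0..<m})"

definition high :: "(int \<Rightarrow> int) \<Rightarrow> int" where
  "high k = Max (level k ` {0..<m})"

text \<open>In \<open>toggle\<close> it is applied to \<open>lo\<close> alone, so switching
  \<open>hi\<close> does not move the point and is an involution. The position of the first minimum
  is unaffected by translations.\<close>

definition argmin :: "(int \<Rightarrow> int) \<Rightarrow> int" where
  "argmin k = Min {x \<in> {0..<m}. level k x = low k}"

text \<open>The reflection exchanges \<open>lo x\<close> and \<open>lo x + 1\<close>; it acts at all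
  translates of the point by multiples of \<open>m\<close> to keep \<open>hi\<close>
  quasiperiodic.\<close>

definition toggle :: "(int \<Rightarrow> int) \<Rightarrow> (int \<Rightarrow> int) \<Rightarrow> int \<Rightarrow> int" where
  "toggle lo hi x = (if x mod m = argmin lo then 2 * lo x + 1 - hi x else hi x)"

text \<open>
  On passing to a coface with the same width, \<open>lo\<close> can only decrease and its minimal level is fixed,
  which the second entry detects; if \<open>lo\<close> stays the same, so does the switching point, and \<open>hi\<close> can
  only increase elsewhere, which the third entry detects. The second entry subtracts \<open>low lo\<close> to make
  the key invariant under translations.
\<close>

definition key :: "(int \<Rightarrow> int) \<Rightarrow> (int \<Rightarrow> int) \<Rightarrow> int \<times> int \<times> int" where
  "key lo hi = (low lo - high hi, (\<Sum>x\<in>{0..<m}. lo x) - low lo,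
     - (\<Sum>x\<in>{0..<m} - {argmin lo}. hi x - lo x))"

lemma level_mod: "quasiperiodic k \<Longrightarrow> level k (x mod m) = level k x"
proof -
  assume "quasiperiodic k"
  from quasiperiodic_mod[OF this, of x] have *: "k x = k (x mod m) + s * (x div m)" .
  have "x = x mod m + m * (x div m)" by simp
  then have "s * x = s * (x mod m) + s * (m * (x div m))" by (metis distrib_left)
  with * show ?thesis by (simp add: level_def algebra_simps)
qed

lemma nonempty_m: "{0..<m} \<noteq> {}" using m_ge by simp

lemma low_le: "quasiperiodic k \<Longrightarrow> low k \<le> level k x"
proof -
  assume k: "quasiperiodic k"
  have "low k \<le> level k (x mod m)"
    unfolding low_def by (rule Min_le) (use m_ge in auto)
  then show ?thesis using level_mod[OF k] by simp
qed

lemma high_ge: "quasiperiodic k \<Longrightarrow> level k x \<le> high k"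
proof -
  assume k: "quasiperiodic k"
  have "level k (x mod m) \<le> high k"
    unfolding high_def by (rule Max_ge) (use m_ge in auto)
  then show ?thesis using level_mod[OF k] by simp
qed

lemma low_attained: "\<exists>x\<in>{0..<m}. level k x = low k"
  using Min_in[of "level k ` {0..<m}"] nonempty_m unfolding low_def by fastforce

lemma high_attained: "\<exists>x\<in>{0..<m}. level k x = high k"
  using Max_in[of "level k ` {0..<m}"] nonempty_m unfolding high_def by fastforce

lemma argmin: "argmin k \<in> {0..<m}" "level k (argmin k) = low k"
proof -
  let ?S = "{x \<in> {0..<m}. level k x = low k}"
  have "finite ?S" by (rule finite_subset[of _ "{0..<m}"]) auto
  moreover have "?S \<noteq> {}" using low_attained by blast
  ultimately have "Min ?S \<in> ?S" by (rule Min_in)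
  then show "argmin k \<in> {0..<m}" "level k (argmin k) = low k"
    unfolding argmin_def by auto
qed

text \<open>A cell determines its lift up to translation only, so the behaviour under shifts decides
  which data of a lift belong to the cell.\<close>

lemma low_shift: "low (\<lambda>x. k x + e) = low k + m * e"
proof -
  have "level (\<lambda>x. k x + e) = (\<lambda>x. level k x + m * e)"
    by (simp add: level_def algebra_simps fun_eq_iff)
  then show ?thesis
    unfolding low_def using Min_add_commute[of "{0..<m}" "level k" "m * e"] nonempty_m by simp
qed

lemma high_shift: "high (\<lambda>x. k x + e) = high k + m * e"
proof -
  have "level (\<lambda>x. k x + e) = (\<lambda>x. level k x + m * e)"
    by (simp add: level_def algebra_simps fun_eq_iff)
  then show ?thesis
    unfolding high_def using Max_add_commute[of "{0..<m}" "level k" "m * e"] nonempty_m by simp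
qed

lemma argmin_shift: "argmin (\<lambda>x. k x + e) = argmin k"
  unfolding argmin_def low_shift by (simp add: level_def algebra_simps)

lemma key_shift: "key (\<lambda>x. lo x + e) (\<lambda>x. hi x + e) = key lo hi"
  using m_ge by (simp add: key_def low_shift high_shift argmin_shift sum.distrib)

lemma toggle_shift: "toggle (\<lambda>x. lo x + e) (\<lambda>x. hi x + e) = (\<lambda>x. toggle lo hi x + e)"
  by (auto simp: toggle_def argmin_shift)

lemma low_mono:
  assumes "quasiperiodic k" and "\<And>x. k x \<le> l x"
  shows "low k \<le> low l"
proof -
  obtain x where "level l x = low l" using low_attained by blast
  moreover have "level k x \<le> level l x" using assms(2)[of x] m_ge by (simp add: level_def)
  ultimately show ?thesis using low_le[OF assms(1), of x] by linarith
qed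

lemma high_mono:
  assumes "quasiperiodic l" and "\<And>x. k x \<le> l x"
  shows "high k \<le> high l"
proof -
  obtain x where "level k x = high k" using high_attained by blast
  moreover have "level k x \<le> level l x" using assms(2)[of x] m_ge by (simp add: level_def)
  ultimately show ?thesis using high_ge[OF assms(1), of x] by linarith
qed

lemma quasiperiodic_eqI:
  assumes "quasiperiodic k" "quasiperiodic l" "\<And>x. x \<in> {0..<m} \<Longrightarrow> k x = l x"
  shows "k = l"
proof
  fix x
  have "k (x mod m) = l (x mod m)" using assms(3) m_ge by simp
  then show "k x = l x" using quasiperiodic_mod[OF assms(1), of x] quasiperiodic_mod[OF assms(2), of x]
    by simp
qed

text \<open>The slope \<open>s / m\<close> lies strictly between 0 and 1. If \<open>k\<close> did
  not rise after the minimum, the level would fall by at least \<open>s\<close>; if \<open>k\<close>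
  rose on the way to it, the level before would be lower by at least \<open>m - s\<close>.\<close>

lemma minimum_is_corner:
  assumes "quasiperiodic k" and "level k x = low k"
  shows "k x + 1 \<le> k (x + 1)" "k x \<le> k (x - 1)"
proof -
  have "level k x \<le> level k (x + 1)" using low_le[OF assms(1), of "x + 1"] assms(2) by simp
  then have "m * (k (x + 1) - k x) \<ge> s" by (simp add: level_def algebra_simps)
  then have "m * (k (x + 1) - k x) > 0" using s_pos by linarith
  then show "k x + 1 \<le> k (x + 1)" using m_ge by (simp add: zero_less_mult_iff)
  have "level k x \<le> level k (x - 1)" using low_le[OF assms(1), of "x - 1"] assms(2) by simp
  then have "m * (k x - k (x - 1)) \<le> s" by (simp add: level_def algebra_simps)
  then have "m * (k x - k (x - 1)) < m * 1" using s_less by linarith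
  then show "k x \<le> k (x - 1)" using m_ge mult_less_cancel_left_pos[of m "k x - k (x - 1)" 1] by simp
qed

section \<open>Effect of the switch on interval, dimension and key\<close>

lemma toggle_quasiperiodic:
  assumes "quasiperiodic lo" "quasiperiodic hi"
  shows "quasiperiodic (toggle lo hi)"
  using assms by (simp add: quasiperiodic_def toggle_def)

text \<open>Only raising \<open>hi\<close> to \<open>lo + 1\<close> needs an argument, and the
  corner of \<open>lo\<close> leaves room for it on both sides.\<close>

lemma toggle_interlaced:
  assumes "interlaced lo hi"
  shows "interlaced lo (toggle lo hi)"
proof -
  note quasi = interlaced_quasiperiodic[OF assms]
  have corner: "lo x + 1 \<le> lo (x + 1)" "lo x \<le> lo (x - 1)" if "x mod m = argmin lo" for x
  proof -
    have "level lo x = low lo" using level_mod[OF quasi(1), of x] argmin(2)[of lo] that by simp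
    from minimum_is_corner[OF quasi(1) this]
    show "lo x + 1 \<le> lo (x + 1)" "lo x \<le> lo (x - 1)" by auto
  qed
  show ?thesis
    unfolding interlaced_def
  proof (intro conjI allI)
    fix x
    note bounds = interlaced_bounds[OF assms, of x] interlaced_bounds[OF assms, of "x + 1"]
    show "lo x \<le> toggle lo hi x" using bounds by (simp add: toggle_def)
    show "toggle lo hi x \<le> lo (x + 1)" using bounds corner(1)[of x] by (auto simp: toggle_def)
    show "toggle lo hi (x + 1) \<le> lo x + 1"
      using bounds corner(2)[of "x + 1"] by (auto simp: toggle_def)
  qed (use quasi toggle_quasiperiodic in auto)
qed

lemma toggle_toggle: "toggle lo (toggle lo hi) = hi"
  by (auto simp: toggle_def)

text \<open>At the switching point the old and the new level are at most \<open>low lo + m\<close>,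
  which is below \<open>high hi\<close>. So the maximum is attained elsewhere, where
  \<open>toggle\<close> changes nothing.\<close>

lemma high_toggle:
  assumes "interlaced lo hi" and "high hi - low lo > m"
  shows "high (toggle lo hi) = high hi"
proof -
  have small: "level (toggle lo hi) (argmin lo) \<le> low lo + m" "level hi (argmin lo) \<le> low lo + m"
  proof -
    let ?a = "argmin lo"
    have "m * hi ?a \<le> m * (lo ?a + 1)" "m * toggle lo hi ?a \<le> m * (lo ?a + 1)"
      using interlaced_bounds(2)[OF assms(1)] interlaced_bounds(2)[OF toggle_interlaced[OF assms(1)]] m_ge
      by (auto intro!: mult_left_mono)
    then show "level (toggle lo hi) ?a \<le> low lo + m" "level hi ?a \<le> low lo + m"
      unfolding argmin(2)[symmetric] by (simp_all add: level_def algebra_simps)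
  qed
  have off: "level (toggle lo hi) x = level hi x" if "x \<in> {0..<m}" "x \<noteq> argmin lo" for x
    using that by (simp add: level_def toggle_def)
  have quasi: "quasiperiodic hi" by (rule interlaced_quasiperiodic[OF assms(1)])
  obtain x where x: "x \<in> {0..<m}" "level hi x = high hi" using high_attained by blast
  then have "x \<noteq> argmin lo" using small(2) assms(2) by auto
  then have "level (toggle lo hi) x = high hi" using off x by simp
  moreover have "level (toggle lo hi) y \<le> high hi" if "y \<in> {0..<m}" for y
    using off[OF that] small(1) assms(2) high_ge[OF quasi, of y] by (cases "y = argmin lo") auto
  ultimately show ?thesis
    unfolding high_def[of "toggle lo hi"] using x(1) by (intro Max_eqI) (auto intro: rev_image_eqI)
qed

text \<open>The third entry of the key leaves out the switching point for this purpose.\<close>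

lemma key_toggle:
  assumes "interlaced lo hi" and "high hi - low lo > m"
  shows "key lo (toggle lo hi) = key lo hi"
proof -
  have "(\<Sum>x\<in>{0..<m} - {argmin lo}. toggle lo hi x - lo x) =
      (\<Sum>x\<in>{0..<m} - {argmin lo}. hi x - lo x)"
    by (rule sum.cong) (auto simp: toggle_def)
  then show ?thesis by (simp add: key_def high_toggle[OF assms])
qed

lemma cell_dim_cell:
  assumes "interlaced lo hi"
  shows "int (cell_dim (cycle_graph m) (cell c lo hi)) = (\<Sum>x\<in>{0..<m}. hi x - lo x)"
proof -
  have "int (card (cell c lo hi x) - 1) = hi x - lo x" if "x \<in> {0..<m}" for x
  proof (cases "hi x = lo x")
    case True
    then show ?thesis using that by (simp add: cell_apply pos_def)
  next
    case False
    then have *: "hi x = lo x + 1" using interlaced_bounds(1,2)[OF assms, of x] by linarith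
    \<comment> \<open>As \<open>p\<close> does not divide 1, the two ends have different positions
      and the factor is a true edge.\<close>
    have "\<not> p dvd -1" using p_ge zdvd_not_zless[of 1 p] by simp
    then have "pos c lo x \<noteq> pos c hi x"
      using dvd_double_iff[of "-1"] * by (simp add: pos_eq_iff)
    then show ?thesis using that * by (simp add: cell_apply)
  qed
  then show ?thesis by (simp add: cell_dim_def cycle_graph_def)
qed

text \<open>Only the factor at the switching point changes, from a point to an edge or back; the
  last term encodes the sign.\<close>

lemma cell_dim_toggle:
  assumes "interlaced lo hi"
  shows "int (cell_dim (cycle_graph m) (cell c lo (toggle lo hi))) =
    int (cell_dim (cycle_graph m) (cell c lo hi)) + 1 - 2 * (hi (argmin lo) - lo (argmin lo))"
proof -
  let ?a = "argmin lo"
  have "(\<Sum>x\<in>{0..<m}. toggle lo hi x - lo x) =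
      toggle lo hi ?a - lo ?a + (\<Sum>x\<in>{0..<m} - {?a}. toggle lo hi x - lo x)"
    using argmin(1) by (intro sum.remove) auto
  also have "(\<Sum>x\<in>{0..<m} - {?a}. toggle lo hi x - lo x) = (\<Sum>x\<in>{0..<m} - {?a}. hi x - lo x)"
    by (rule sum.cong) (auto simp: toggle_def)
  also have "toggle lo hi ?a = 2 * lo ?a + 1 - hi ?a"
    using argmin(1)[of lo] by (simp add: toggle_def)
  finally show ?thesis
    unfolding cell_dim_cell[OF assms] cell_dim_cell[OF toggle_interlaced[OF assms]]
    using sum.remove[OF finite_atLeastLessThan_int argmin(1), of "\<lambda>x. hi x - lo x" lo] by simp
qed

text \<open>Yields the hypothesis \<open>decreasing\<close> of \<open>collapses_matching\<close>. On
  passing to a coface, each entry of the key can only drop as long as the earlier ones stay the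
  same; if none drops, the two intervals agree away from the switching point.\<close>

lemma key_decreasing:
  assumes "interlaced lo hi" "interlaced lo' hi'"
    and le: "\<And>x. lo' x \<le> lo x" "\<And>x. hi x \<le> hi' x"
    and "hi (argmin lo) = lo (argmin lo)"
  shows "lo' = lo \<and> (hi' = hi \<or> hi' = toggle lo hi) \<or> key lo' hi' < key lo hi"
proof (cases "key lo' hi' < key lo hi")
  case False
  note quasi = interlaced_quasiperiodic[OF assms(1)] interlaced_quasiperiodic[OF assms(2)]
  have mono: "low lo' \<le> low lo" "high hi \<le> high hi'"
    using low_mono[OF quasi(3) le(1)] high_mono[OF quasi(4) le(2)] .
  \<comment> \<open>Both \<open>low\<close> and \<open>- high\<close> can only decrease, so equality
    of the first entries fixes each of them.\<close>
  with False have low: "low lo' = low lo" "high hi' = high hi"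
    by (auto simp: key_def less_prod_def')
  have sum_le: "(\<Sum>x\<in>{0..<m}. lo' x) \<le> (\<Sum>x\<in>{0..<m}. lo x)"
    using le(1) by (intro sum_mono)
  with False low have "(\<Sum>x\<in>{0..<m}. lo' x) = (\<Sum>x\<in>{0..<m}. lo x)"
    by (auto simp: key_def less_prod_def')
  then have "(\<Sum>x\<in>{0..<m}. lo x - lo' x) = 0" by (simp add: sum_subtractf)
  then have "lo' x = lo x" if "x \<in> {0..<m}" for x
    using that le(1) by (subst (asm) sum_nonneg_eq_0_iff) auto
  then have lo: "lo' = lo" using quasiperiodic_eqI quasi by blast
  let ?R = "{0..<m} - {argmin lo}"
  have "(\<Sum>x\<in>?R. hi x - lo x) \<le> (\<Sum>x\<in>?R. hi' x - lo x)"
    using le(2) by (intro sum_mono diff_right_mono)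
  with False low lo have "(\<Sum>x\<in>?R. hi x - lo x) = (\<Sum>x\<in>?R. hi' x - lo x)"
    by (auto simp: key_def less_prod_def')
  then have "(\<Sum>x\<in>?R. hi' x - hi x) = 0" by (simp add: sum_subtractf)
  then have off: "hi' x = hi x" if "x \<in> ?R" for x
    using that le(2) by (subst (asm) sum_nonneg_eq_0_iff) auto
  \<comment> \<open>The interval has length at most 1 here, which leaves just the two cells of the
    matched pair.\<close>
  have "hi' (argmin lo) = hi (argmin lo) \<or> hi' (argmin lo) = lo (argmin lo) + 1"
    using assms(5) lo interlaced_bounds(1,2)[OF assms(2), of "argmin lo"] by auto
  then show ?thesis
  proof
    assume *: "hi' (argmin lo) = hi (argmin lo)"
    have "hi' = hi"
      by (rule quasiperiodic_eqI[OF quasi(4,2)]) (use * off in blast)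
    then show ?thesis using lo by simp
  next
    assume *: "hi' (argmin lo) = lo (argmin lo) + 1"
    have "hi' = toggle lo hi"
      by (rule quasiperiodic_eqI[OF quasi(4) toggle_quasiperiodic[OF quasi(1,2)]])
        (use * off assms(5) in \<open>auto simp: toggle_def\<close>)
    then show ?thesis using lo by simp
  qed
qed simp

section \<open>The matching on cells and the collapse to \<open>critical\<close>\<close>

text \<open>This definition and the next one pick any lift of \<sigma>; the shift lemmas for
  \<open>key\<close> and \<open>toggle\<close> make the result independent of it.\<close>

definition cell_key :: "(int \<Rightarrow> int set) \<Rightarrow> int \<times> int \<times> int" where
  "cell_key \<sigma> = (SOME q. \<exists>c\<in>C. \<exists>lo hi. interlaced lo hi \<and> \<sigma> = cell c lo hi \<and> q = key lo hi)"

definition cell_match :: "(int \<Rightarrow> int set) \<Rightarrow> int \<Rightarrow> int set" where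
  "cell_match \<sigma> = (SOME \<tau>. \<exists>c\<in>C. \<exists>lo hi. interlaced lo hi \<and> \<sigma> = cell c lo hi \<and>
     \<tau> = cell c lo (toggle lo hi))"

lemma cell_shift: "cell c (\<lambda>x. lo x + p * e) (\<lambda>x. hi x + p * e) = cell c lo hi"
proof -
  have "pos c (\<lambda>x. k x + p * e) x = pos c k x" for k x
    unfolding pos_eq_iff using dvd_double_iff[of "p * e"] by simp
  then show ?thesis by (simp add: cell_def)
qed

lemma cell_key_cell:
  assumes "c \<in> C" "interlaced lo hi"
  shows "cell_key (cell c lo hi) = key lo hi"
  unfolding cell_key_def
proof (rule some_equality)
  fix q assume "\<exists>c'\<in>C. \<exists>lo' hi'. interlaced lo' hi' \<and> cell c lo hi = cell c' lo' hi' \<and> q = key lo' hi'"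
  then obtain c' lo' hi' where *: "c' \<in> C" "interlaced lo' hi'" "cell c lo hi = cell c' lo' hi'"
    "q = key lo' hi'" by blast
  then obtain e where "\<And>x. lo x = lo' x + p * e" "\<And>x. hi x = hi' x + p * e"
    using cell_eq_iff[OF assms(2) *(2) assms(1) *(1)] by blast
  then have "lo = (\<lambda>x. lo' x + p * e)" "hi = (\<lambda>x. hi' x + p * e)" by blast+
  then show "q = key lo hi" using *(4) key_shift by simp
qed (use assms in blast)

lemma cell_match_cell:
  assumes "c \<in> C" "interlaced lo hi"
  shows "cell_match (cell c lo hi) = cell c lo (toggle lo hi)"
  unfolding cell_match_def
proof (rule some_equality)
  fix \<tau> assume "\<exists>c'\<in>C. \<exists>lo' hi'. interlaced lo' hi' \<and> cell c lo hi = cell c' lo' hi' \<and>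
    \<tau> = cell c' lo' (toggle lo' hi')"
  then obtain c' lo' hi' where *: "c' \<in> C" "interlaced lo' hi'" "cell c lo hi = cell c' lo' hi'"
    "\<tau> = cell c' lo' (toggle lo' hi')" by blast
  then obtain e where c: "c = c'" and "\<And>x. lo x = lo' x + p * e" "\<And>x. hi x = hi' x + p * e"
    using cell_eq_iff[OF assms(2) *(2) assms(1) *(1)] by blast
  then have "lo = (\<lambda>x. lo' x + p * e)" "hi = (\<lambda>x. hi' x + p * e)" by blast+
  then show "\<tau> = cell c lo (toggle lo hi)"
    unfolding *(4) c using toggle_shift cell_shift by simp
qed (use assms in blast)

text \<open>The first entry of the key is minus the width, so these are the cells of width at most
  \<open>m\<close>.\<close>

definition critical :: "(int \<Rightarrow> int set) set" where
  "critical = {\<sigma> \<in> winding_subcomplex m n w. - m \<le> fst (cell_key \<sigma>)}"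

lemma cell_critical_iff:
  assumes "c \<in> C" "interlaced lo hi"
  shows "cell c lo hi \<in> critical \<longleftrightarrow> high hi - low lo \<le> m"
  using cell_key_cell[OF assms] cell_in_winding_subcomplex[OF assms(2)]
  by (auto simp: critical_def key_def)

lemma toggle_face:
  assumes "interlaced lo hi" "c \<in> C" "hi (argmin lo) = lo (argmin lo)"
  shows "cell c lo hi \<in> faces (cycle_graph m) (cell c lo (toggle lo hi))"
proof -
  note quasi = interlaced_quasiperiodic[OF assms(1)]
  have "hi x = lo x" if "x mod m = argmin lo" for x
    using quasiperiodic_mod[OF quasi(1), of x] quasiperiodic_mod[OF quasi(2), of x] that assms(3)
    by simp
  then have "\<forall>x. lo x + p * 0 \<le> lo x \<and> hi x \<le> toggle lo hi x + p * 0"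
    by (simp add: toggle_def)
  then show ?thesis
    using cell_in_faces_iff[OF assms(1) toggle_interlaced[OF assms(1)] assms(2,2)] by blast
qed

lemma collapses_critical:
  "collapses (cycle_graph m) (winding_subcomplex m n w) critical"
proof (rule collapses_matching[where key = cell_key and match = cell_match])
  show "finite (winding_subcomplex m n w)" by (rule finite_winding_subcomplex)
  show "critical \<subseteq> winding_subcomplex m n w" by (auto simp: critical_def)
next
  fix \<tau> assume \<tau>: "\<tau> \<in> winding_subcomplex m n w - critical"
  then have "\<tau> \<in> winding_subcomplex m n w" by simp
  then obtain c lo hi where c: "c \<in> C" and i: "interlaced lo hi" and eq: "\<tau> = cell c lo hi"
    by (rule cell_lift)
  from \<tau> have D: "high hi - low lo > m" using cell_critical_iff[OF c i] eq by auto
  note i' = toggle_interlaced[OF i]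
  note match = cell_match_cell[OF c i]
  have "cell_match \<tau> \<notin> critical"
    unfolding eq match cell_critical_iff[OF c i'] high_toggle[OF i D] using D by simp
  moreover have "cell_match (cell_match \<tau>) = \<tau>"
    unfolding eq match cell_match_cell[OF c i'] toggle_toggle ..
  moreover have "cell_key (cell_match \<tau>) = cell_key \<tau>"
    unfolding eq match cell_key_cell[OF c i'] cell_key_cell[OF c i] by (rule key_toggle[OF i D])
  moreover have "cell_match \<tau> \<in> winding_subcomplex m n w"
    unfolding eq match by (rule cell_in_winding_subcomplex[OF i'])
  ultimately show "cell_match \<tau> \<in> winding_subcomplex m n w - critical \<and>
      cell_match (cell_match \<tau>) = \<tau> \<and> cell_key (cell_match \<tau>) = cell_key \<tau>" by blast
  let ?a = "argmin lo"
  \<comment> \<open>Switching gives a coface if the factor at \<open>?a\<close> is a point, and a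
    face if it is an edge.\<close>
  have "hi ?a = lo ?a \<or> hi ?a = lo ?a + 1" using interlaced_bounds(1,2)[OF i, of ?a] by linarith
  then show "\<tau> \<in> faces (cycle_graph m) (cell_match \<tau>) \<and>
      cell_dim (cycle_graph m) (cell_match \<tau>) = cell_dim (cycle_graph m) \<tau> + 1 \<or>
      cell_match \<tau> \<in> faces (cycle_graph m) \<tau> \<and>
      cell_dim (cycle_graph m) \<tau> = cell_dim (cycle_graph m) (cell_match \<tau>) + 1"
  proof
    assume *: "hi ?a = lo ?a"
    then show ?thesis
      using toggle_face[OF i c *] cell_dim_toggle[OF i, of c] unfolding eq match by simp
  next
    assume *: "hi ?a = lo ?a + 1"
    then have "toggle lo hi ?a = lo ?a" using argmin(1)[of lo] by (simp add: toggle_def)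
    from toggle_face[OF i' c this] have "cell_match \<tau> \<in> faces (cycle_graph m) \<tau>"
      unfolding eq match toggle_toggle .
    moreover have "int (cell_dim (cycle_graph m) (cell_match \<tau>)) =
        int (cell_dim (cycle_graph m) \<tau>) - 1"
      unfolding eq match using cell_dim_toggle[OF i, of c] * by simp
    ultimately show ?thesis by simp
  qed
  fix \<rho> assume up: "cell_dim (cycle_graph m) (cell_match \<tau>) = cell_dim (cycle_graph m) \<tau> + 1"
    and \<rho>: "\<rho> \<in> winding_subcomplex m n w" "\<tau> \<in> faces (cycle_graph m) \<rho>"
  have a: "hi ?a = lo ?a"
    using up cell_dim_toggle[OF i, of c] unfolding eq match by simp
  obtain c' lo1 hi1 where c': "c' \<in> C" and i1: "interlaced lo1 hi1" and eq1: "\<rho> = cell c' lo1 hi1"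
    using \<rho>(1) by (rule cell_lift)
  obtain e where cc: "c = c'" and e: "\<forall>x. lo1 x + p * e \<le> lo x \<and> hi x \<le> hi1 x + p * e"
    using \<rho>(2) cell_in_faces_iff[OF i i1 c c'] unfolding eq eq1 by blast
  \<comment> \<open>The lift of \<rho> is translated so that its interval contains that of
    \<tau>.\<close>
  define lo' where "lo' x = lo1 x + p * e" for x
  define hi' where "hi' x = hi1 x + p * e" for x
  have i2: "interlaced lo' hi'"
    using i1 by (simp add: interlaced_def quasiperiodic_def lo'_def hi'_def)
  have eq2: "\<rho> = cell c lo' hi'"
    unfolding eq1 cc using cell_shift[of c' lo1 e hi1] by (simp add: lo'_def[abs_def] hi'_def[abs_def])
  have le: "lo' x \<le> lo x" "hi x \<le> hi' x" for x using e by (auto simp: lo'_def hi'_def)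
  \<comment> \<open>The width is monotone under inclusion of intervals, so no coface of a
    noncritical cell is critical.\<close>
  have "high hi' - low lo' > m"
    using D low_mono[OF interlaced_quasiperiodic(1)[OF i2] le(1)]
      high_mono[OF interlaced_quasiperiodic(2)[OF i2] le(2)] by linarith
  then have "\<rho> \<notin> critical" unfolding eq2 cell_critical_iff[OF c i2] by simp
  moreover have "\<rho> = \<tau> \<or> \<rho> = cell_match \<tau> \<or> cell_key \<rho> < cell_key \<tau>"
    using key_decreasing[OF i i2 le a] unfolding eq match eq2 cell_key_cell[OF c i] cell_key_cell[OF c i2]
    by blast
  ultimately show "\<rho> = \<tau> \<or> \<rho> = cell_match \<tau> \<or>
      \<rho> \<in> winding_subcomplex m n w - critical \<and> cell_key \<rho> < cell_key \<tau>"
    using \<rho>(1) by blast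
qed

section \<open>Staircase functions\<close>

definition g :: int where "g = gcd m s"

definition period :: int where "period = m div g * p"

text \<open>The highest integer points on or below a line of slope \<open>s / m\<close>. Offsets
  that are multiples of \<open>g\<close> suffice: as \<open>g\<close> divides \<open>s\<close> and
  \<open>m\<close>, other offsets give the same functions.\<close>

definition stair :: "int \<Rightarrow> int \<Rightarrow> int" where
  "stair t x = (g * t + s * x) div m"

definition cube :: "int \<Rightarrow> int \<Rightarrow> int \<Rightarrow> int set" where
  "cube c t = cell c (stair t) (stair (t + 1))"

definition corner :: "int \<Rightarrow> int \<Rightarrow> int \<Rightarrow> int" where
  "corner c t = (\<lambda>x\<in>{0..<m}. pos c (stair t) x)"

text \<open>\<open>g\<close> divides the positive numbers \<open>s\<close> and \<open>m - s\<close>.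
  The last two bounds are what makes consecutive staircases interlaced.\<close>

lemma g_pos: "g > 0" and g_dvd: "g dvd m" "g dvd s" and g_le: "g \<le> s" "g + s \<le> m"
proof -
  show "g > 0" "g dvd m" "g dvd s" using m_ge by (auto simp: g_def)
  then show "g \<le> s" using s_pos zdvd_imp_le by blast
  have "g dvd m - s" using \<open>g dvd m\<close> \<open>g dvd s\<close> by (rule dvd_diff)
  then have "g \<le> m - s" using s_less zdvd_imp_le[of g "m - s"] by simp
  then show "g + s \<le> m" by simp
qed

lemma period_pos: "period > 0"
proof -
  have "g \<le> m" using g_dvd(1) m_ge zdvd_imp_le by simp
  then have "m div g > 0" using g_pos by (simp add: pos_imp_zdiv_pos_iff)
  then show ?thesis using p_ge by (simp add: period_def)
qed

lemma stair_quasiperiodic: "quasiperiodic (stair t)"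
  unfolding quasiperiodic_def
proof
  fix x
  have "g * t + s * (x + m) = (g * t + s * x) + s * m" by (simp add: algebra_simps)
  then have "stair t (x + m) = (g * t + s * x + s * m) div m" by (simp only: stair_def)
  then show "stair t (x + m) = stair t x + s" using m_ge by (simp add: stair_def)
qed

lemma stair_mono: "t \<le> t' \<Longrightarrow> stair t x \<le> stair t' x"
  unfolding stair_def using g_pos m_ge by (intro zdiv_mono1) auto

text \<open>The numerator grows by \<open>g\<close> with \<open>t\<close> and by \<open>s\<close>
  with \<open>x\<close>, so everything reduces to \<open>g \<le> s\<close> and
  \<open>g + s \<le> m\<close>.\<close>

lemma stair_interlaced: "interlaced (stair t) (stair (t + 1))" "interlaced (stair t) (stair t)"
proof -
  have *: "stair (t + 1) x \<le> stair t (x + 1)" for x t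
    unfolding stair_def using g_le(1) m_ge by (intro zdiv_mono1) (auto simp: algebra_simps)
  have "stair (t + 1) (x + 1) \<le> (g * t + s * x + m) div m" for x t
    unfolding stair_def using g_le(2) m_ge by (intro zdiv_mono1) (auto simp: algebra_simps)
  then have **: "stair (t + 1) (x + 1) \<le> stair t x + 1" for x t
    using m_ge by (simp add: stair_def)
  have mono: "stair t x \<le> stair (t + 1) x" for x t by (rule stair_mono) simp
  show "interlaced (stair t) (stair (t + 1))"
    using * ** mono stair_quasiperiodic by (auto simp: interlaced_def)
  have "stair t x \<le> stair t (x + 1)" for x
    using *[of t x] mono[of t x] by linarith
  moreover have "stair t (x + 1) \<le> stair t x + 1" for x
    using **[of t x] mono[of t "x + 1"] by linarith
  ultimately show "interlaced (stair t) (stair t)"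
    using stair_quasiperiodic by (auto simp: interlaced_def)
qed

lemma stair_shift: "stair (t + period * e) x = stair t x + p * e"
proof -
  have "g * (t + period * e) + s * x = g * t + s * x + g * (m div g) * (p * e)"
    by (simp add: period_def algebra_simps)
  also have "g * (m div g) = m" using g_dvd(1) by simp
  finally have "g * (t + period * e) + s * x = g * t + s * x + m * (p * e)" .
  then have "stair (t + period * e) x = (g * t + s * x + m * (p * e)) div m"
    by (simp only: stair_def)
  then show ?thesis using m_ge by (simp add: stair_def)
qed

text \<open>Dividing by \<open>g\<close> leaves a congruence modulo \<open>m div g\<close> whose
  coefficient is invertible.\<close>

lemma card_residues: "int (card {x \<in> {0..<m}. m dvd g * u + s * x}) = g"
proof -
  obtain k a where k: "g * k = m" and a: "g * a = s" using g_dvd by (metis dvdE)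
  have "0 < g * k" using k m_ge by simp
  then have "k > 0" using g_pos by (simp add: zero_less_mult_iff)
  have "gcd (g * k) (g * a) = g" unfolding k a by (simp add: g_def)
  then have "g * gcd k a = g * 1" using g_pos by (simp add: gcd_mult_left)
  then have "gcd k a = 1" using g_pos by (simp only: mult_cancel_left) simp
  then have cop: "coprime a k" by (simp add: coprime_iff_gcd_eq_1 gcd.commute)
  have "m dvd g * u + s * x \<longleftrightarrow> k dvd u + a * x" for x
  proof -
    have "g * u + (g * a) * x = g * (u + a * x)" by (simp add: algebra_simps)
    then have "g * k dvd g * u + (g * a) * x \<longleftrightarrow> k dvd u + a * x" using g_pos by simp
    then show ?thesis unfolding k a .
  qed
  then show ?thesis using card_linear_cong[OF g_pos \<open>k > 0\<close> cop, of u] unfolding k by simp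
qed

text \<open>The remainder is a multiple of \<open>g\<close> below \<open>m\<close>.\<close>

lemma stair_mod_le: "(g * t + s * x) mod m \<le> m - g"
proof -
  have "g dvd (g * t + s * x) mod m" using g_dvd by (simp add: dvd_mod)
  then have "g dvd m - (g * t + s * x) mod m" using g_dvd(1) by (rule dvd_diff[rotated])
  moreover have "m - (g * t + s * x) mod m > 0" using m_ge by simp
  ultimately have "g \<le> m - (g * t + s * x) mod m" by (intro zdvd_imp_le)
  then show ?thesis by simp
qed

text \<open>From \<open>t\<close> to \<open>t + 1\<close> the remainder modulo \<open>m\<close>
  grows by \<open>g\<close>. It was at most \<open>m - g\<close>, so if it wraps around, it becomes
  exactly 0.\<close>

lemma stair_step: "stair (t + 1) x - stair t x = (if m dvd g * (t + 1) + s * x then 1 else 0)"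
proof -
  define \<rho> where "\<rho> u = (g * u + s * x) mod m" for u
  have \<rho>: "0 \<le> \<rho> u" "\<rho> u \<le> m - g" for u
    using m_ge stair_mod_le by (simp_all add: \<rho>_def)
  have "g * u + s * x = m * stair u x + \<rho> u" for u by (simp add: \<rho>_def stair_def)
  from this[of t] this[of "t + 1"]
  have step: "\<rho> (t + 1) = \<rho> t + g - m * (stair (t + 1) x - stair t x)"
    by (simp add: distrib_left right_diff_distrib)
  have dvd: "m dvd g * (t + 1) + s * x \<longleftrightarrow> \<rho> (t + 1) = 0"
    unfolding \<rho>_def by (rule dvd_eq_mod_eq_0)
  have "stair (t + 1) x - stair t x = 0 \<or> stair (t + 1) x - stair t x = 1"
    using interlaced_bounds(1,2)[OF stair_interlaced(1), of t x] by linarith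
  then show ?thesis
  proof
    assume eq: "stair (t + 1) x - stair t x = 0"
    have "\<rho> (t + 1) > 0" using step \<rho>(1)[of t] g_pos unfolding eq by simp
    then show ?thesis unfolding dvd eq by simp
  next
    assume eq: "stair (t + 1) x - stair t x = 1"
    have "\<rho> (t + 1) = 0" using step \<rho>(2)[of t] \<rho>(1)[of "t + 1"] unfolding eq by simp
    then show ?thesis unfolding dvd eq by simp
  qed
qed

lemma sum_stair_step: "(\<Sum>x\<in>{0..<m}. stair (t + 1) x - stair t x) = g"
  unfolding stair_step using card_residues[of "t + 1"] by (simp add: sum.If_cases Int_def)

lemma cell_dim_cube: "int (cell_dim (cycle_graph m) (cube c t)) = g"
  unfolding cube_def cell_dim_cell[OF stair_interlaced(1)] by (rule sum_stair_step)

text \<open>For \<open>u < t\<close> the assumption would squeeze \<open>stair (u + 1)\<close> below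
  \<open>stair u\<close>, although it is larger at \<open>g\<close> points of each period.\<close>

lemma stair_le_imp:
  assumes "\<And>x. stair t x \<le> stair u x" shows "t \<le> u"
proof (rule ccontr)
  assume "\<not> t \<le> u"
  then have "stair (u + 1) x \<le> stair t x" for x by (intro stair_mono) simp
  then have "stair (u + 1) x - stair u x \<le> 0" for x
    using assms[of x] order_trans[of "stair (u + 1) x" "stair t x" "stair u x"] by simp
  then have "(\<Sum>x\<in>{0..<m}. stair (u + 1) x - stair u x) \<le> 0" by (intro sum_nonpos) blast
  then show False using sum_stair_step[of u] g_pos by simp
qed

lemma stair_inj:
  assumes "\<And>x. stair t x = stair u x" shows "t = u"
proof (rule antisym)
  show "t \<le> u" by (rule stair_le_imp) (simp add: assms)
  show "u \<le> t" by (rule stair_le_imp) (simp add: assms)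
qed

text \<open>The level of \<open>stair t\<close> is \<open>g * t\<close> minus a remainder, hence
  between \<open>g * t - m + g\<close> and \<open>g * t\<close>. So the levels between
  \<open>stair t\<close> and \<open>stair (t + 1)\<close> fill a range of length \<open>m\<close>,
  and a suitable \<open>t\<close> adapts this range to a given interval.\<close>

lemma high_low_le_iff:
  assumes "interlaced lo hi"
  shows "high hi - low lo \<le> m \<longleftrightarrow> (\<exists>t. \<forall>x. stair t x \<le> lo x \<and> hi x \<le> stair (t + 1) x)"
proof
  assume le: "high hi - low lo \<le> m"
  note quasi = interlaced_quasiperiodic[OF assms]
  have "g dvd low lo"
    unfolding argmin(2)[symmetric] level_def using g_dvd by (intro dvd_diff dvd_mult2)
  then have "g dvd low lo + m - g" using g_dvd by simp
  \<comment> \<open>This \<open>t\<close> puts the lower end of the range at \<open>low lo\<close>;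
    the upper end \<open>g * (t + 1)\<close> is then \<open>low lo + m\<close>.\<close>
  then obtain t where t: "low lo + m - g = g * t" by (auto elim: dvdE)
  have "stair t x \<le> lo x \<and> hi x \<le> stair (t + 1) x" for x
  proof
    have "low lo \<le> level lo x" by (rule low_le[OF quasi(1)])
    then have "g * t + s * x < m * (lo x + 1)"
      using t g_pos by (simp add: level_def algebra_simps)
    then show "stair t x \<le> lo x" unfolding stair_def using int_div_le_iff m_ge by simp
    have "level hi x \<le> high hi" by (rule high_ge[OF quasi(2)])
    then have "m * hi x \<le> g * (t + 1) + s * x"
      using t le by (simp add: level_def algebra_simps)
    then have "\<not> g * (t + 1) + s * x < m * (hi x - 1 + 1)" by simp
    then have "\<not> stair (t + 1) x \<le> hi x - 1"
      unfolding stair_def using int_div_le_iff[of m _ "hi x - 1"] m_ge by simp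
    then show "hi x \<le> stair (t + 1) x" by simp
  qed
  then show "\<exists>t. \<forall>x. stair t x \<le> lo x \<and> hi x \<le> stair (t + 1) x" by blast
next
  assume "\<exists>t. \<forall>x. stair t x \<le> lo x \<and> hi x \<le> stair (t + 1) x"
  then obtain t where t: "\<And>x. stair t x \<le> lo x" "\<And>x. hi x \<le> stair (t + 1) x" by blast
  obtain x where x: "level lo x = low lo" using low_attained by blast
  have "m * stair t x \<le> m * lo x" using t(1) m_ge by (intro mult_left_mono) auto
  moreover have "m * stair t x = g * t + s * x - (g * t + s * x) mod m"
    by (simp add: stair_def minus_mod_eq_mult_div)
  ultimately have 1: "g * t - m + g \<le> low lo"
    using x stair_mod_le[of t x] by (simp add: level_def)
  obtain y where y: "level hi y = high hi" using high_attained by blast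
  have "m * hi y \<le> m * stair (t + 1) y" using t(2) m_ge by (intro mult_left_mono) auto
  moreover have "m * stair (t + 1) y = g * (t + 1) + s * y - (g * (t + 1) + s * y) mod m"
    by (simp add: stair_def minus_mod_eq_mult_div)
  moreover have "0 \<le> (g * (t + 1) + s * y) mod m" using m_ge by simp
  ultimately have "high hi \<le> g * (t + 1)" using y by (simp add: level_def)
  then show "high hi - low lo \<le> m" using 1 by (simp add: algebra_simps)
qed

section \<open>The cubes between consecutive staircases and their circle\<close>

lemma mod_period_iff: "t mod period = u mod period \<longleftrightarrow> (\<exists>e. t = u + period * e)"
  unfolding mod_eq_dvd_iff by (auto simp: dvd_def algebra_simps)

text \<open>Translating a staircase by \<open>p * e\<close> moves its index by
  \<open>period * e\<close>, so the translations in \<open>cell_in_faces_iff\<close> turn into the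
  choice of an index \<open>u\<close>.\<close>

lemma cell_in_faces_cube_iff:
  assumes "interlaced lo hi" "c \<in> C" "c' \<in> C"
  shows "cell c lo hi \<in> faces (cycle_graph m) (cube c' t) \<longleftrightarrow> c = c' \<and>
    (\<exists>u. u mod period = t mod period \<and> (\<forall>x. stair u x \<le> lo x \<and> hi x \<le> stair (u + 1) x))"
proof -
  have "stair t x + p * e = stair (t + period * e) x"
    "stair (t + 1) x + p * e = stair (t + period * e + 1) x" for x e
    using stair_shift[of t e x] stair_shift[of "t + 1" e x] by (simp_all add: algebra_simps)
  then show ?thesis
    unfolding cube_def cell_in_faces_iff[OF assms(1) stair_interlaced(1) assms(2,3)] mod_period_iff
    by auto
qed

lemma cube_cong: "t mod period = u mod period \<Longrightarrow> cube c t = cube c u"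
proof -
  assume "t mod period = u mod period"
  then obtain e where e: "t = u + period * e" unfolding mod_period_iff by blast
  then have "stair t = (\<lambda>x. stair u x + p * e)"
    "stair (t + 1) = (\<lambda>x. stair (u + 1) x + p * e)"
    using stair_shift[of u e] stair_shift[of "u + 1" e] by (auto simp: algebra_simps)
  then show ?thesis unfolding cube_def by (simp only: cell_shift)
qed

lemma corner_cong: "t mod period = u mod period \<Longrightarrow> corner c t = corner c u"
proof -
  assume "t mod period = u mod period"
  then obtain e where e: "t = u + period * e" unfolding mod_period_iff by blast
  have "pos c (stair t) x = pos c (stair u) x" for x
    unfolding pos_eq_iff e stair_shift using dvd_double_iff[of "p * e"] by simp
  then show ?thesis by (simp add: corner_def)
qed

lemma vertex_cell_corner: "vertex_cell (cycle_graph m) (corner c t) = cell c (stair t) (stair t)"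
  by (simp add: vertex_cell_def cycle_graph_def corner_def cell_def cong: restrict_cong)

lemma corner_eq_iff:
  assumes "c \<in> C"
  shows "corner c t = corner c u \<longleftrightarrow> t mod period = u mod period"
proof
  assume "corner c t = corner c u"
  then have "cell c (stair t) (stair t) = cell c (stair u) (stair u)"
    using vertex_cell_corner by metis
  then obtain e where "\<And>x. stair t x = stair u x + p * e"
    using cell_eq_iff[OF stair_interlaced(2) stair_interlaced(2) assms assms] by blast
  then have "stair t x = stair (u + period * e) x" for x by (simp add: stair_shift)
  then have "t = u + period * e" by (rule stair_inj)
  then show "t mod period = u mod period" unfolding mod_period_iff by blast
qed (rule corner_cong)

lemma cube_eq_iff:
  assumes "c \<in> C" "c' \<in> C"
  shows "cube c t = cube c' u \<longleftrightarrow> c = c' \<and> t mod period = u mod period"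
proof
  assume "cube c t = cube c' u"
  then obtain e where "c = c'" "\<And>x. stair t x = stair u x + p * e"
    unfolding cube_def cell_eq_iff[OF stair_interlaced(1) stair_interlaced(1) assms] by blast
  then have "stair t x = stair (u + period * e) x" for x by (simp add: stair_shift)
  then have "t = u + period * e" by (rule stair_inj)
  with \<open>c = c'\<close> show "c = c' \<and> t mod period = u mod period" unfolding mod_period_iff by blast
qed (use cube_cong in blast)

lemma cube_in_winding_subcomplex: "cube c t \<in> winding_subcomplex m n w"
  unfolding cube_def by (rule cell_in_winding_subcomplex[OF stair_interlaced(1)])

lemma face_cube_lift:
  assumes "\<sigma> \<in> faces (cycle_graph m) (cube c t)" "c \<in> C"
  obtains lo hi u where "interlaced lo hi" "\<sigma> = cell c lo hi" "u mod period = t mod period"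
    "\<And>x. stair u x \<le> lo x" "\<And>x. hi x \<le> stair (u + 1) x"
proof -
  have "\<sigma> \<in> winding_subcomplex m n w"
    using face_in_winding_subcomplex[OF m_ge cube_in_winding_subcomplex assms(1)] .
  then obtain c' lo hi where *: "c' \<in> C" "interlaced lo hi" "\<sigma> = cell c' lo hi" by (rule cell_lift)
  with assms cell_in_faces_cube_iff[OF *(2,1) assms(2), of t] that show ?thesis by blast
qed

lemma critical_eq: "critical = (\<Union>Q\<in>(\<Union>c\<in>C. cube c ` {0..<period}). faces (cycle_graph m) Q)"
proof (intro equalityI subsetI)
  fix \<sigma> assume \<sigma>: "\<sigma> \<in> critical"
  then have "\<sigma> \<in> winding_subcomplex m n w" by (simp add: critical_def)
  then obtain c lo hi where *: "c \<in> C" "interlaced lo hi" "\<sigma> = cell c lo hi" by (rule cell_lift)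
  then obtain t where t: "\<forall>x. stair t x \<le> lo x \<and> hi x \<le> stair (t + 1) x"
    using \<sigma> cell_critical_iff[OF *(1,2)] high_low_le_iff[OF *(2)] by blast
  have "t mod period = t mod period mod period" by simp
  then have "\<sigma> \<in> faces (cycle_graph m) (cube c (t mod period))"
    unfolding *(3) cell_in_faces_cube_iff[OF *(2,1,1)] using t by blast
  moreover have "t mod period \<in> {0..<period}" using period_pos by simp
  ultimately show "\<sigma> \<in> (\<Union>Q\<in>(\<Union>c\<in>C. cube c ` {0..<period}). faces (cycle_graph m) Q)"
    using *(1) by blast
next
  fix \<sigma> assume "\<sigma> \<in> (\<Union>Q\<in>(\<Union>c\<in>C. cube c ` {0..<period}). faces (cycle_graph m) Q)"
  then obtain c t where c: "c \<in> C" and "\<sigma> \<in> faces (cycle_graph m) (cube c t)" by blast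
  from this(2,1) show "\<sigma> \<in> critical"
  proof (rule face_cube_lift)
    fix lo hi u assume *: "interlaced lo hi" "\<sigma> = cell c lo hi"
      "\<And>x. stair u x \<le> lo x" "\<And>x. hi x \<le> stair (u + 1) x"
    then show "\<sigma> \<in> critical"
      unfolding *(2) cell_critical_iff[OF c *(1)] high_low_le_iff[OF *(1)] by blast
  qed
qed

lemma corner_in_cube:
  "corner c t \<in> cell_vertices (cycle_graph m) (cube c t)"
  "corner c (t + 1) \<in> cell_vertices (cycle_graph m) (cube c t)"
  by (simp_all add: corner_def cube_def cell_def cell_vertices_def cycle_graph_def)

lemma corners_opposite:
  "diagonally_opposite (cycle_graph m) (cube c t) (corner c t) (corner c (t + 1))"
  unfolding diagonally_opposite_def
  using corner_in_cube by (auto simp: cycle_graph_def cube_def cell_def corner_def)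

text \<open>A common face lies between \<open>stair u\<close> and \<open>stair (u + 1)\<close> and
  also between \<open>stair u'\<close> and \<open>stair (u' + 1)\<close>. If \<open>u < u'\<close>,
  this forces \<open>u' = u + 1\<close> and leaves only the vertex given by \<open>stair u'\<close>,
  a corner of both cubes.\<close>

lemma faces_cube_Int:
  assumes "c \<in> C" and "t mod period \<noteq> t' mod period"
  shows "faces (cycle_graph m) (cube c t) \<inter> faces (cycle_graph m) (cube c t') =
    vertex_cell (cycle_graph m) `
      ({corner c t, corner c (t + 1)} \<inter> {corner c t', corner c (t' + 1)})"
proof (intro equalityI subsetI)
  fix \<sigma> assume \<sigma>: "\<sigma> \<in> faces (cycle_graph m) (cube c t) \<inter> faces (cycle_graph m) (cube c t')"
  have meet: "\<sigma> = vertex_cell (cycle_graph m) (corner c u') \<and> u' = u + 1"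
    if "interlaced lo hi" "\<sigma> = cell c lo hi" "u < u'" "\<And>x. stair u' x \<le> lo x"
      "\<And>x. hi x \<le> stair (u + 1) x" for lo hi u u'
  proof -
    have le: "stair u' x \<le> lo x \<and> lo x \<le> hi x \<and> hi x \<le> stair (u + 1) x" for x
      using that(4,5) interlaced_bounds(1)[OF that(1)] by blast
    then have "stair u' x \<le> stair (u + 1) x" for x by (meson order_trans)
    then have "u' \<le> u + 1" by (rule stair_le_imp)
    then have u': "u' = u + 1" using that(3) by simp
    then have "lo x = stair u' x \<and> hi x = stair u' x" for x using le[of x] by auto
    then have "lo = stair u'" "hi = stair u'" by blast+
    then show ?thesis using that(2) u' vertex_cell_corner by simp
  qed
  have "\<sigma> \<in> faces (cycle_graph m) (cube c t)" using \<sigma> by blast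
  then obtain lo hi u where u: "interlaced lo hi" "\<sigma> = cell c lo hi" "u mod period = t mod period"
    "\<And>x. stair u x \<le> lo x" "\<And>x. hi x \<le> stair (u + 1) x"
    using assms(1) by (rule face_cube_lift) blast
  \<comment> \<open>The lift found for the first cube is kept, so that \<open>u\<close> and
    \<open>u'\<close> can be compared as integers and not just as residues.\<close>
  have "cell c lo hi \<in> faces (cycle_graph m) (cube c t')" using \<sigma> u(2) by blast
  then obtain u' where u': "u' mod period = t' mod period"
    "\<And>x. stair u' x \<le> lo x" "\<And>x. hi x \<le> stair (u' + 1) x"
    unfolding cell_in_faces_cube_iff[OF u(1) assms(1,1)] by blast
  have corners: "corner c u = corner c t" "corner c u' = corner c t'"
    "corner c (u + 1) = corner c (t + 1)" "corner c (u' + 1) = corner c (t' + 1)"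
    using u(3) u'(1) by (auto intro!: corner_cong intro: mod_add_cong)
  have "u \<noteq> u'" using u(3) u'(1) assms(2) by auto
  then consider "u < u'" | "u' < u" by linarith
  then show "\<sigma> \<in> vertex_cell (cycle_graph m) `
      ({corner c t, corner c (t + 1)} \<inter> {corner c t', corner c (t' + 1)})"
  proof cases
    case 1
    from meet[OF u(1,2) 1 u'(2) u(5)]
    have "\<sigma> = vertex_cell (cycle_graph m) (corner c t')" "corner c t' = corner c (t + 1)"
      using corners by auto
    then show ?thesis by blast
  next
    case 2
    from meet[OF u(1,2) 2 u(4) u'(3)]
    have "\<sigma> = vertex_cell (cycle_graph m) (corner c t)" "corner c t = corner c (t' + 1)"
      using corners by auto
    then show ?thesis by blast
  qed
next
  have ext: "corner c u \<in> extensional (pverts (cycle_graph m))" for u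
    by (simp add: corner_def cycle_graph_def)
  fix \<sigma> assume "\<sigma> \<in> vertex_cell (cycle_graph m) `
      ({corner c t, corner c (t + 1)} \<inter> {corner c t', corner c (t' + 1)})"
  then obtain \<phi> where \<phi>: "\<sigma> = vertex_cell (cycle_graph m) \<phi>"
    "\<phi> \<in> {corner c t, corner c (t + 1)}" "\<phi> \<in> {corner c t', corner c (t' + 1)}" by blast
  then have "\<phi> \<in> extensional (pverts (cycle_graph m))" using ext by blast
  moreover have "\<phi> \<in> cell_vertices (cycle_graph m) (cube c t)"
    "\<phi> \<in> cell_vertices (cycle_graph m) (cube c t')"
    using \<phi>(2,3) corner_in_cube by auto
  ultimately show "\<sigma> \<in> faces (cycle_graph m) (cube c t) \<inter> faces (cycle_graph m) (cube c t')"
    unfolding \<phi>(1) by (simp add: vertex_cell_in_faces_iff)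
qed

lemma linked_cubes:
  assumes "c \<in> C"
  shows "linked_to_circle (cycle_graph m) (cube c ` {0..<period})"
proof -
  define N where "N = nat period"
  have N: "int N = period" "N > 0" using period_pos by (auto simp: N_def)
  \<comment> \<open>Closes the circle: index \<open>N\<close> returns to 0, and a corner depends
    only on its index modulo \<open>period\<close>.\<close>
  have suc: "corner c (int (Suc i mod N)) = corner c (int i + 1)" for i
    by (rule corner_cong) (simp add: zmod_int N(1) add.commute)
  have small: "int i mod period = int i" if "i < N" for i using that N(1) by simp
  have image: "int ` {..<N} = {0..<period}"
    using image_int_atLeastLessThan[of 0 N] N(1) by (simp add: atLeast0LessThan)
  show ?thesis
    unfolding linked_to_circle_def
  proof (intro exI conjI allI impI)
    show "N > 0" by (rule N(2))
    have "inj_on (\<lambda>i. cube c (int i)) {..<N}"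
      using cube_eq_iff[OF assms assms] small by (auto simp: inj_on_def)
    moreover have "(\<lambda>i. cube c (int i)) ` {..<N} = cube c ` {0..<period}"
      unfolding image[symmetric] image_image ..
    ultimately show "bij_betw (\<lambda>i. cube c (int i)) {..<N} (cube c ` {0..<period})"
      by (simp add: bij_betw_def)
    show "inj_on (\<lambda>i. corner c (int i)) {..<N}"
      using corner_eq_iff[OF assms] small by (auto simp: inj_on_def)
    show "diagonally_opposite (cycle_graph m) (cube c (int i)) (corner c (int i))
        (corner c (int (Suc i mod N)))" for i
      unfolding suc by (rule corners_opposite)
    show "faces (cycle_graph m) (cube c (int i)) \<inter> faces (cycle_graph m) (cube c (int j)) =
        vertex_cell (cycle_graph m) ` ({corner c (int i), corner c (int (Suc i mod N))} \<inter>
          {corner c (int j), corner c (int (Suc j mod N))})" if "i < N" "j < N" "i \<noteq> j" for i j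
      unfolding suc using that small by (intro faces_cube_Int[OF assms]) simp
  qed
qed

text \<open>A common face would determine both base points.\<close>

lemma faces_cube_disjoint:
  assumes "c \<in> C" "c' \<in> C" "c \<noteq> c'"
  shows "faces (cycle_graph m) (cube c t) \<inter> faces (cycle_graph m) (cube c' u) = {}"
proof (rule equals0I)
  fix \<sigma> assume \<sigma>: "\<sigma> \<in> faces (cycle_graph m) (cube c t) \<inter> faces (cycle_graph m) (cube c' u)"
  then have "\<sigma> \<in> faces (cycle_graph m) (cube c t)" by blast
  then obtain lo hi where i: "interlaced lo hi" and eq: "\<sigma> = cell c lo hi"
    using assms(1) by (rule face_cube_lift) blast
  have "cell c lo hi \<in> faces (cycle_graph m) (cube c' u)" using \<sigma> unfolding eq by simp
  then show False using assms(3) unfolding cell_in_faces_cube_iff[OF i assms(1,2)] by simp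
qed

lemma card_cubes:
  assumes "finite C"
  shows "int (card (\<Union>c\<in>C. cube c ` {0..<period})) = int (card C) * period"
proof -
  have "(\<Union>c\<in>C. cube c ` {0..<period}) = (\<lambda>(c, t). cube c t) ` (C \<times> {0..<period})" by auto
  moreover have "inj_on (\<lambda>(c, t). cube c t) (C \<times> {0..<period})"
    using cube_eq_iff by (auto simp: inj_on_def)
  ultimately show ?thesis
    using period_pos assms by (simp add: card_image card_cartesian_product)
qed

lemma collapses_cubes:
  assumes "finite C" "\<Q> = (\<Union>c\<in>C. cube c ` {0..<period})"
  shows "\<Q> \<subseteq> winding_subcomplex m n w"
    "int (card \<Q>) = int (card C) * period"
    "\<forall>Q\<in>\<Q>. is_cube (cycle_graph m) Q \<and> int (cell_dim (cycle_graph m) Q) = gcd m s"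
    "collapses (cycle_graph m) (winding_subcomplex m n w) (\<Union>Q\<in>\<Q>. faces (cycle_graph m) Q)"
proof -
  show sub: "\<Q> \<subseteq> winding_subcomplex m n w" using cube_in_winding_subcomplex assms(2) by blast
  then show "\<forall>Q\<in>\<Q>. is_cube (cycle_graph m) Q \<and> int (cell_dim (cycle_graph m) Q) = gcd m s"
    using is_cube_hom_complex_cycle[OF m_ge n_ge] cell_dim_cube
    by (auto simp: assms(2) winding_subcomplex_def g_def)
  show "int (card \<Q>) = int (card C) * period" using card_cubes assms by simp
  show "collapses (cycle_graph m) (winding_subcomplex m n w) (\<Union>Q\<in>\<Q>. faces (cycle_graph m) Q)"
    using collapses_critical unfolding critical_eq assms(2) .
qed

end

section \<open>The two parities of \<open>n\<close>, and the theorem\<close>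

text \<open>For odd \<open>n\<close>, 2 is invertible modulo \<open>n\<close>, so
  \<open>p = n\<close> and steps of 2 reach every residue from one base point.\<close>

lemma cycle_lift_odd:
  fixes m n w s :: int
  assumes "m \<ge> 2" "n \<ge> 3" "0 < s" "s < m" "2 * s = m + n * w" "odd n"
  shows "cycle_lift m n w s n {0}"
proof
  have cop: "coprime n 2" using assms(6) by simp
  show "n dvd 2 * a \<longleftrightarrow> n dvd a" for a
    using cop by (simp add: coprime_dvd_mult_right_iff)
  show "\<exists>c\<in>{0}. \<exists>k. n dvd c + 2 * k - y" for y
  proof (cases "even y")
    case True
    then have "0 + 2 * (y div 2) - y = 0" by simp
    then show ?thesis by (metis dvd_0_right singletonI)
  next
    case False
    \<comment> \<open>Adding the odd number \<open>n\<close> makes \<open>y\<close> even without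
      changing its residue.\<close>
    then have "0 + 2 * ((y + n) div 2) - y = n" using assms(6) by simp
    then show ?thesis by (metis dvd_refl singletonI)
  qed
qed (use assms in auto)

text \<open>For even \<open>n\<close>, steps of 2 preserve parity modulo \<open>n\<close>, so each
  parity needs its own base point and 2 has order \<open>n div 2\<close>.\<close>

lemma cycle_lift_even:
  fixes m n w s :: int
  assumes "m \<ge> 2" "n \<ge> 3" "n \<noteq> 4" "0 < s" "s < m" "2 * s = m + n * w" "even n"
  shows "cycle_lift m n w s (n div 2) {0, 1}"
proof
  obtain p where p: "n = 2 * p" using assms(7) by (auto elim: dvdE)
  \<comment> \<open>An even \<open>n \<ge> 3\<close> other than 4 is at least 6.\<close>
  show "n div 2 \<ge> 3" using p assms(2,3) by simp
  show "n dvd 2 * a \<longleftrightarrow> n div 2 dvd a" for a by (simp add: p)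
  show "c = c'" if "c \<in> {0, 1}" "c' \<in> {0, 1}" "n dvd c - c' + 2 * a" for c c' a
  proof -
    have "even (c - c' + 2 * a)" using assms(7) that(3) dvd_trans by blast
    then have "even (c - c')" by simp
    then show ?thesis using that(1,2) by auto
  qed
  show "\<exists>c\<in>{0, 1}. \<exists>k. n dvd c + 2 * k - y" for y
  proof -
    have "y mod 2 + 2 * (y div 2) - y = 0" by simp
    then have "n dvd y mod 2 + 2 * (y div 2) - y" by simp
    moreover have "y mod 2 \<in> {0, 1}" by auto
    ultimately show ?thesis by (intro bexI[of _ "y mod 2"] exI[of _ "y div 2"])
  qed
qed (use assms in auto)

theorem corollary8p4:
  fixes m n w r :: int
  assumes "m \<ge> 5" and "n \<ge> 3" and "n \<noteq> 4" and "w \<ge> 0"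
    and "even (m - n * w)" and "r = (m - n * w) div 2" and "r > 0"
  shows "\<exists>\<Q>. \<Q> \<subseteq> winding_subcomplex m n w \<and>
    int (card \<Q>) = m * n div gcd m r \<and>
    (\<forall>Q\<in>\<Q>. is_cube (cycle_graph m) Q \<and> int (cell_dim (cycle_graph m) Q) = gcd m r) \<and>
    collapses (cycle_graph m) (winding_subcomplex m n w) (\<Union>Q\<in>\<Q>. faces (cycle_graph m) Q) \<and>
    (if even m \<and> even n then linked_to_two_circles (cycle_graph m) \<Q>
     else linked_to_circle (cycle_graph m) \<Q>)"
proof -
  \<comment> \<open>For a map of winding number \<open>w\<close>, \<open>s\<close> counts the steps
    up and \<open>r\<close> the steps down.\<close>
  define s where "s = m - r"
  have r: "m - n * w = 2 * r" using assms(5,6) by simp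
  then have s_eq: "2 * s = m + n * w" by (simp add: s_def)
  have "0 \<le> n * w" using assms(2,4) by simp
  \<comment> \<open>Nonnegativity of \<open>w\<close> gives \<open>s > 0\<close>, and
    \<open>r > 0\<close> gives \<open>s < m\<close>.\<close>
  then have s: "0 < s" "s < m" using s_eq assms(1,7) by (auto simp: s_def)
  have "gcd m (m - s) = gcd m s"
    unfolding gcd.commute[of m] by (rule gcd_diff2)
  then have gcd: "gcd m r = gcd m s" by (simp add: s_def)
  have count: "m * n div gcd m s = m div gcd m s * n"
    using dvd_div_mult[of "gcd m s" m n] by simp
  show ?thesis
  proof (cases "even n")
    case False
    interpret cycle_lift m n w s n "{0}"
      using assms(1,2) s s_eq False by (intro cycle_lift_odd) auto
    define \<Q> where "\<Q> = (\<Union>c\<in>{0}. cube c ` {0..<period})"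
    from collapses_cubes[OF _ \<Q>_def] linked_cubes[of 0] False show ?thesis
      by (intro exI[of _ \<Q>]) (auto simp: \<Q>_def gcd count period_def g_def)
  next
    case True
    interpret cycle_lift m n w s "n div 2" "{0, 1}"
      using assms(1,2,3) s s_eq True by (intro cycle_lift_even) auto
    \<comment> \<open>As \<open>m - n * w\<close> is even, \<open>m\<close> is even whenever
      \<open>n\<close> is; so two circles occur exactly for even \<open>n\<close>.\<close>
    have "even m" using assms(5) True by simp
    define \<Q> where "\<Q> = (\<Union>c\<in>{0, 1}. cube c ` {0..<period})"
    have "linked_to_two_circles (cycle_graph m) \<Q>"
      unfolding linked_to_two_circles_def
    proof (intro exI conjI)
      show "\<Q> = cube 0 ` {0..<period} \<union> cube 1 ` {0..<period}" by (auto simp: \<Q>_def)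
      show "(\<Union>A\<in>cube 0 ` {0..<period}. faces (cycle_graph m) A) \<inter>
          (\<Union>B\<in>cube 1 ` {0..<period}. faces (cycle_graph m) B) = {}"
        using faces_cube_disjoint[of 0 1] by (simp add: Int_UN_distrib2)
      show "linked_to_circle (cycle_graph m) (cube 0 ` {0..<period})"
        "linked_to_circle (cycle_graph m) (cube 1 ` {0..<period})"
        by (rule linked_cubes; simp)+
    qed
    \<comment> \<open>There are two circles of \<open>m div g * (n div 2)\<close> cubes
      each.\<close>
    moreover have "int (card \<Q>) = m * n div gcd m r"
      using collapses_cubes(2)[OF _ \<Q>_def] True by (simp add: gcd count period_def g_def)
    moreover have "finite {0, 1 :: int}" by simp
    note collapses_cubes(1,3,4)[OF this \<Q>_def]
    ultimately show ?thesis
      using True \<open>even m\<close> unfolding gcd by (intro exI[of _ \<Q>] conjI) simp_all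
  qed
qed

end
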